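(* There exists an isometric embedding $f:\mathrm{DA}(\mathbb{T})\to\Gamma=\mathfrak{S}_q\wr F_{q+1}$, i.e. a map $f$ such that $d_\Gamma(f(x),f(y))=d_{\mathrm{DA}}(x,y)$ for all $x,y\in\mathrm{DA}(\mathbb{T})$.
   Context: Tree and groups. Fix an integer $q\ge 2$, let $\mathcal{A}_q=\{0,\dots,q-1\}$, and let the symmetric group $\mathfrak{S}_q$ act on $\mathcal{A}_q$ on the right, $t\mapsto t.\sigma$. For $m\in\mathbb{Z}$ let $H_m$ be the set of sequences $(u_k)_{k\le m}$ indexed by integers $k\le m$, with values in $\mathcal{A}_q$, and equal to $0$ for all sufficiently negative $k$. The $(q+1)$-regular tree $\mathbb{T}$ has vertex set $\bigsqcup_{m\in\mathbb{Z}}H_m$, each vertex of $H_m$ being joined by an edge to its ancestor in $H_{m-1}$ obtained by deleting the last entry; for a vertex $v$ and $t\in\mathcal{A}_q$, $vt$ is the child of $v$ obtained by appending $t$. Let $\omega(n)\in H_{-n}$ be the zero sequence, $o=\omega(0)$, and $\omega$ the end of $\mathbb{T}$ represented by the ray $(\omega(n))_{n\ge0}$. $\mathrm{Aff}(\mathbb{T})$ is the group of graph automorphisms of $\mathbb{T}$ fixing $\omega$; it acts on the right ($v\mapsto v.g$; in $gh$, $g$ is applied first). Put $\beta(v)=m$ for $v\in H_m$ and let $\Phi:\mathrm{Aff}(\mathbb{T})\to\mathbb{Z}$ be the homomorphism $\Phi(g)=\beta(v.g)-\beta(v)$ (independent of $v$), with kernel $\mathrm{Hor}(\mathbb{T})$.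 Let $\alpha\in\mathrm{Aff}(\mathbb{T})$ be the shift $(u_k)_{k\le m}\mapsto(u_{k-1})_{k\le m+1}$, so $\Phi(\alpha)=1$. For $\gamma\in\mathrm{Hor}(\mathbb{T})$ the portrait of $\gamma$ is the function $v\mapsto\gamma[v]\in\mathfrak{S}_q$ determined by $(vt).\gamma=(v.\gamma)(t.\gamma[v])$ for all vertices $v$ and $t\in\mathcal{A}_q$. Every $g\in\mathrm{Aff}(\mathbb{T})$ is uniquely $g=\gamma\alpha^m$ with $\gamma\in\mathrm{Hor}(\mathbb{T})$, $m\in\mathbb{Z}$, and one sets $g[v]:=\gamma[v]$. The discrete affine group is $\mathrm{DA}(\mathbb{T})=\{g\in\mathrm{Aff}(\mathbb{T}): g[v]=e \text{ for all but finitely many } v\}$. For $\sigma\in\mathfrak{S}_q$, $\delta_o^\sigma\in\mathrm{Hor}(\mathbb{T})$ is the element with portrait equal to $\sigma$ at $o$ and $e$ elsewhere. $S_1=\{\delta_o^{\sigma}\alpha^{\varepsilon}\delta_o^{\sigma'}:\sigma,\sigma'\in\mathfrak{S}_q,\varepsilon=\pm1\}$ is a symmetric generating set of $\mathrm{DA}(\mathbb{T})$, and $d_{\mathrm{DA}}(x,y)=|x^{-1}y|_{S_1}$ is the corresponding word metric. Wreath product. For groups $H,F$, $H\wr F=(\bigoplus_F H)\rtimes F$ where $x\in F$ acts on $\varphi\in\bigoplus_F H$ (finitely supported functions $F\to H$) by $\varphi\mapsto\varphi(x^{-1}\cdot)$. $F_{q+1}$ is the free product of $q+1$ copies of $\mathbb{Z}_2=\mathbb{Z}/2\mathbb{Z}$,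 with $S_F$ the standard generating set of $q+1$ involutions (its Cayley graph is a $(q+1)$-regular tree). For $h\in\mathfrak{S}_q$, $\delta_e^h\in\bigoplus_{F_{q+1}}\mathfrak{S}_q$ takes value $h$ at the identity $e$ of $F_{q+1}$ and is trivial elsewhere; $\mathbf{1}$ is the trivial function. $\Gamma=\mathfrak{S}_q\wr F_{q+1}$ is equipped with the "switch-walk-switch" generating set $\{(\delta_e^{h_1},e)(\mathbf{1},s)(\delta_e^{h_2},e): h_1,h_2\in\mathfrak{S}_q, s\in S_F\}$ and $d_\Gamma(x,y)=|x^{-1}y|_\Gamma$ is the corresponding word metric. *)

theory Defs
  imports "HOL-Algebra.Algebra" "HOL-Combinatorics.Permutations"
begin

section \<open>Word metrics\<close>

text \<open>The length is meaningful for elements of the monoid generated by \<open>S\<close>. Words have letters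
  in \<open>S\<close> only, not in \<open>S\<close> together with its inverses: the sets used below are symmetric.\<close>

definition word_length :: "('a, 'b) monoid_scheme \<Rightarrow> 'a set \<Rightarrow> 'a \<Rightarrow> nat" where
  "word_length G S g = (LEAST n. \<exists>w. set w \<subseteq> S \<and> length w = n \<and>
     foldr (\<lambda>a b. a \<otimes>\<^bsub>G\<^esub> b) w \<one>\<^bsub>G\<^esub> = g)"

definition word_dist :: "('a, 'b) monoid_scheme \<Rightarrow> 'a set \<Rightarrow> 'a \<Rightarrow> 'a \<Rightarrow> nat" where
  "word_dist G S x y = word_length G S (inv\<^bsub>G\<^esub> x \<otimes>\<^bsub>G\<^esub> y)"


section \<open>The symmetric group acting on the right\<close>

text \<open>All actions are on the right: \<open>t.\<sigma>\<close> is \<open>\<sigma> t\<close>, and in a product \<open>\<sigma> \<tau>\<close> the factor \<open>\<sigma>\<close> is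
  applied first, so products are reversed compositions.\<close>

definition Sq :: "nat \<Rightarrow> (nat \<Rightarrow> nat) monoid" where
  "Sq q = \<lparr>carrier = {\<sigma>. \<sigma> permutes {..<q}}, monoid.mult = (\<lambda>\<sigma> \<tau>. \<tau> \<circ> \<sigma>), one = id\<rparr>"


section \<open>The tree\<close>

text \<open>A sequence \<open>(u\<^sub>k)\<close> indexed by \<open>k \<le> m\<close> is encoded as the pair \<open>(m, u)\<close> with \<open>u\<close> extended
  by \<open>0\<close> to the integers above \<open>m\<close>.\<close>

type_synonym vertex = "int \<times> (int \<Rightarrow> nat)"

definition level :: "nat \<Rightarrow> int \<Rightarrow> vertex set" where
  "level q m = {(m, u) | u. (\<forall>k. u k < q) \<and> (\<forall>k>m. u k = 0) \<and> (\<exists>N. \<forall>k<N. u k = 0)}"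

definition verts :: "nat \<Rightarrow> vertex set" where
  "verts q = (\<Union>m. level q m)"

definition height :: "vertex \<Rightarrow> int" where
  "height v = fst v"

definition ancestor :: "vertex \<Rightarrow> vertex" where
  "ancestor v = (fst v - 1, (snd v)(fst v := 0))"

definition child :: "vertex \<Rightarrow> nat \<Rightarrow> vertex" where
  "child v t = (fst v + 1, (snd v)(fst v + 1 := t))"

definition adj :: "nat \<Rightarrow> vertex \<Rightarrow> vertex \<Rightarrow> bool" where
  "adj q v w \<longleftrightarrow> v \<in> verts q \<and> w \<in> verts q \<and> (ancestor v = w \<or> ancestor w = v)"

definition omega_ray :: "nat \<Rightarrow> vertex" where
  "omega_ray n = (- int n, \<lambda>_. 0)"

definition origin :: vertex where
  "origin = omega_ray 0"

definition rays :: "nat \<Rightarrow> (nat \<Rightarrow> vertex) set" where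
  "rays q = {r. inj r \<and> (\<forall>n. adj q (r n) (r (Suc n)))}"

text \<open>Ends are classes of rays, two rays being equivalent if they have a common tail.\<close>

definition end_of :: "nat \<Rightarrow> (nat \<Rightarrow> vertex) \<Rightarrow> (nat \<Rightarrow> vertex) set" where
  "end_of q r = {s \<in> rays q. \<exists>a b. \<forall>n. s (n + a) = r (n + b)}"


section \<open>The affine group of the tree\<close>

text \<open>By the definition of \<open>permutes\<close>, automorphisms are extended by the identity outside the
  vertex set, so that equality of functions is equality of automorphisms.\<close>

definition Aff :: "nat \<Rightarrow> (vertex \<Rightarrow> vertex) monoid" where
  "Aff q = \<lparr>carrier = {g. g permutes verts q \<and>
              (\<forall>v\<in>verts q. \<forall>w\<in>verts q. adj q (g v) (g w) \<longleftrightarrow> adj q v w) \<and>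
              (\<lambda>r. g \<circ> r) ` end_of q omega_ray = end_of q omega_ray},
            monoid.mult = (\<lambda>g h. h \<circ> g), one = id\<rparr>"

text \<open>The height shift does not depend on the vertex at which it is measured.\<close>

definition Phi :: "(vertex \<Rightarrow> vertex) \<Rightarrow> int" where
  "Phi g = height (g origin) - height origin"

definition Hor :: "nat \<Rightarrow> (vertex \<Rightarrow> vertex) set" where
  "Hor q = {g \<in> carrier (Aff q). Phi g = 0}"

definition alpha :: "nat \<Rightarrow> vertex \<Rightarrow> vertex" where
  "alpha q v = (if v \<in> verts q then (fst v + 1, \<lambda>k. snd v (k - 1)) else v)"

definition hor_portrait :: "nat \<Rightarrow> (vertex \<Rightarrow> vertex) \<Rightarrow> vertex \<Rightarrow> nat \<Rightarrow> nat" where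
  "hor_portrait q \<gamma> v = (THE \<sigma>. \<sigma> permutes {..<q} \<and>
     (\<forall>t<q. \<gamma> (child v t) = child (\<gamma> v) (\<sigma> t)))"

definition hor_part :: "nat \<Rightarrow> (vertex \<Rightarrow> vertex) \<Rightarrow> vertex \<Rightarrow> vertex" where
  "hor_part q g = (THE \<gamma>. \<gamma> \<in> Hor q \<and>
     (\<exists>m::int. g = \<gamma> \<otimes>\<^bsub>Aff q\<^esub> (alpha q [^]\<^bsub>Aff q\<^esub> m)))"

definition portrait :: "nat \<Rightarrow> (vertex \<Rightarrow> vertex) \<Rightarrow> vertex \<Rightarrow> nat \<Rightarrow> nat" where
  "portrait q g v = hor_portrait q (hor_part q g) v"

definition DA :: "nat \<Rightarrow> (vertex \<Rightarrow> vertex) monoid" where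
  "DA q = (Aff q)\<lparr>carrier :=
     {g \<in> carrier (Aff q). finite {v \<in> verts q. portrait q g v \<noteq> id}}\<rparr>"

definition delta_o :: "nat \<Rightarrow> (nat \<Rightarrow> nat) \<Rightarrow> vertex \<Rightarrow> vertex" where
  "delta_o q \<sigma> = (THE \<gamma>. \<gamma> \<in> Hor q \<and>
     (\<forall>v\<in>verts q. hor_portrait q \<gamma> v = (if v = origin then \<sigma> else id)))"

definition S1 :: "nat \<Rightarrow> (vertex \<Rightarrow> vertex) set" where
  "S1 q = {delta_o q \<sigma> \<otimes>\<^bsub>DA q\<^esub> (alpha q [^]\<^bsub>DA q\<^esub> \<epsilon>) \<otimes>\<^bsub>DA q\<^esub> delta_o q \<sigma>' | \<sigma> \<sigma>' (\<epsilon>::int).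
     \<sigma> \<in> carrier (Sq q) \<and> \<sigma>' \<in> carrier (Sq q) \<and> \<epsilon> \<in> {1, -1}}"


section \<open>The free product of copies of the group of order two\<close>

text \<open>Elements of the free product of \<open>n\<close> copies of \<open>\<int>/2\<int>\<close> are represented by their normal forms:
  the letter \<open>i\<close> is the nontrivial element of the \<open>i\<close>-th copy, and consecutive letters are
  distinct.\<close>

fun red_cons :: "nat \<Rightarrow> nat list \<Rightarrow> nat list" where
  "red_cons s [] = [s]"
| "red_cons s (t # w) = (if s = t then w else s # t # w)"

definition free_prod_Z2 :: "nat \<Rightarrow> nat list monoid" where
  "free_prod_Z2 n = \<lparr>carrier = {w. set w \<subseteq> {..<n} \<and> distinct_adj w},
     monoid.mult = (\<lambda>x y. foldr red_cons x y), one = []\<rparr>"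

definition free_prod_Z2_gens :: "nat \<Rightarrow> nat list set" where
  "free_prod_Z2_gens n = {[i] | i. i < n}"


section \<open>Wreath products\<close>

definition wreath :: "('h, 'c) monoid_scheme \<Rightarrow> ('f, 'd) monoid_scheme \<Rightarrow> (('f \<Rightarrow> 'h) \<times> 'f) monoid"
  where
  "wreath H F = \<lparr>carrier = carrier (sum_group (carrier F) (\<lambda>_. H)) \<times> carrier F,
     monoid.mult = (\<lambda>(\<phi>, x) (\<psi>, y).
       (\<phi> \<otimes>\<^bsub>sum_group (carrier F) (\<lambda>_. H)\<^esub> (\<lambda>z\<in>carrier F. \<psi> (inv\<^bsub>F\<^esub> x \<otimes>\<^bsub>F\<^esub> z)), x \<otimes>\<^bsub>F\<^esub> y)),
     one = (\<one>\<^bsub>sum_group (carrier F) (\<lambda>_. H)\<^esub>, \<one>\<^bsub>F\<^esub>)\<rparr>"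

definition delta_e :: "('h, 'c) monoid_scheme \<Rightarrow> ('f, 'd) monoid_scheme \<Rightarrow> 'h \<Rightarrow> 'f \<Rightarrow> 'h" where
  "delta_e H F h = (\<lambda>z\<in>carrier F. if z = \<one>\<^bsub>F\<^esub> then h else \<one>\<^bsub>H\<^esub>)"

definition sws_gens :: "('h, 'c) monoid_scheme \<Rightarrow> ('f, 'd) monoid_scheme \<Rightarrow> 'f set \<Rightarrow>
    (('f \<Rightarrow> 'h) \<times> 'f) set" where
  "sws_gens H F S =
     {(delta_e H F h1, \<one>\<^bsub>F\<^esub>) \<otimes>\<^bsub>wreath H F\<^esub> (\<one>\<^bsub>sum_group (carrier F) (\<lambda>_. H)\<^esub>, s)
        \<otimes>\<^bsub>wreath H F\<^esub> (delta_e H F h2, \<one>\<^bsub>F\<^esub>) | h1 h2 s.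
      h1 \<in> carrier H \<and> h2 \<in> carrier H \<and> s \<in> S}"

definition Gamma :: "nat \<Rightarrow> ((nat list \<Rightarrow> nat \<Rightarrow> nat) \<times> nat list) monoid" where
  "Gamma q = wreath (Sq q) (free_prod_Z2 (q + 1))"

definition S_Gamma :: "nat \<Rightarrow> ((nat list \<Rightarrow> nat \<Rightarrow> nat) \<times> nat list) set" where
  "S_Gamma q = sws_gens (Sq q) (free_prod_Z2 (q + 1)) (free_prod_Z2_gens (q + 1))"

end

theory Submission
  imports Defs
begin

text \<open>An element \<open>g\<close> of \<open>DA(T)\<close> is determined by its portrait and its position, the vertex mapped to
  \<open>o\<close>. Right multiplication by a generator changes the portrait at the position, moves the position
  to a neighbour and changes the portrait there, exactly as a lamplighter on the tree with lamps in
  \<open>S\<^sub>q\<close> would do. The tree being the Cayley graph of \<open>F\<^bsub>q+1\<^esub>\<close>, portrait and position together give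
  the embedding. The lamplighter group allows more walks, because in \<open>DA(T)\<close> a step from \<open>v\<close> down
  to \<open>vt\<close> requires \<open>g[v]\<close> to map \<open>t\<close> to \<open>0\<close>. This is harmless between points of the image: at
  the last departure from \<open>v\<close> to \<open>vt\<close> the final lamp at \<open>v\<close> satisfies the requirement, since the
  end position lies below \<open>vt\<close>, and at earlier departures any admissible value will do.\<close>


section \<open>Words and word metrics\<close>

text \<open>In a product \<open>gs\<close> the generator \<open>s\<close> acts after
  \<open>g\<close>, so what \<open>s\<close> does at the origin is felt at the vertex that
  \<open>g\<close> maps there; hence the position is a preimage of the origin. Translating a path of
  \<Gamma> back has to proceed one step at a time, without knowing which departure from a vertex is
  the last. A descent whose prescribed lamp is inadmissible is made with a transposition instead,
  and the discrepancy is remembered. A later return to \<open>v\<close> comes from below, by an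
  ascending step; such steps are always admissible and their second switch is free, so it can
  restore the prescribed lamp. A discrepancy that survives to the end contradicts the position of
  the target. Each step is replaced by exactly one step, so lengths are kept.\<close>

lemma (in group) foldl_mult_eq_mult_foldr:
  assumes "set w \<subseteq> carrier G" "x \<in> carrier G"
  shows "foldl (\<otimes>) x w = x \<otimes> foldr (\<otimes>) w \<one> \<and> foldr (\<otimes>) w \<one> \<in> carrier G"
  using assms by (induction w arbitrary: x) (simp_all add: m_assoc)

text \<open>Reading a word as a path that starts at \<open>x\<close> lets distances in the two
  groups be compared letter by letter.\<close>

lemma (in group) word_dist_eq_Least_foldl:
  assumes S: "S \<subseteq> carrier G" and x: "x \<in> carrier G" and y: "y \<in> carrier G"
  shows "word_dist G S x y = (LEAST n. \<exists>w. set w \<subseteq> S \<and> length w = n \<and> foldl (\<otimes>) x w = y)"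
proof -
  have "foldr (\<otimes>) w \<one> = inv x \<otimes> y \<longleftrightarrow> foldl (\<otimes>) x w = y" if "set w \<subseteq> S" for w
  proof -
    have "set w \<subseteq> carrier G"
      using that S by blast
    from foldl_mult_eq_mult_foldr[OF this x] show ?thesis
      using x y by (metis inv_closed inv_solve_left)
  qed
  then show ?thesis
    unfolding word_dist_def word_length_def by (intro arg_cong[of _ _ Least] ext) blast
qed


section \<open>The group \<open>\<Gamma>\<close>\<close>

lemma carrier_Sq [simp]: "carrier (Sq q) = {\<sigma>. \<sigma> permutes {..<q}}"
  and mult_Sq [simp]: "\<sigma> \<otimes>\<^bsub>Sq q\<^esub> \<tau> = \<tau> \<circ> \<sigma>"
  and one_Sq [simp]: "\<one>\<^bsub>Sq q\<^esub> = id"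
  by (simp_all add: Sq_def)

lemma group_Sq: "group (Sq q)"
proof (rule groupI)
  fix \<sigma> assume "\<sigma> \<in> carrier (Sq q)"
  then show "\<exists>\<tau>\<in>carrier (Sq q). \<tau> \<otimes>\<^bsub>Sq q\<^esub> \<sigma> = \<one>\<^bsub>Sq q\<^esub>"
    by (intro bexI[of _ "inv_into UNIV \<sigma>"]) (simp_all add: permutes_inv permutes_inv_o)
qed (auto simp: permutes_compose permutes_id)

section \<open>Normal forms in the free product\<close>

lemma set_red_cons: "set (red_cons s w) \<subseteq> insert s (set w)"
  by (cases w) auto

lemma distinct_adj_red_cons: "distinct_adj w \<Longrightarrow> distinct_adj (red_cons s w)"
  by (cases w) (auto simp: distinct_adj_ConsD)

lemma red_cons_red_cons: "distinct_adj w \<Longrightarrow> red_cons s (red_cons s w) = w"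
  by (cases w; cases "tl w") (auto simp: distinct_adj_Cons)

lemma set_foldr_red_cons: "set (foldr red_cons x y) \<subseteq> set x \<union> set y"
  by (induction x) (use set_red_cons in fastforce)+

lemma distinct_adj_foldr_red_cons: "distinct_adj y \<Longrightarrow> distinct_adj (foldr red_cons x y)"
  by (induction x) (auto intro: distinct_adj_red_cons)

lemma foldr_red_cons_red_cons:
  "distinct_adj z \<Longrightarrow> foldr red_cons (red_cons s u) z = red_cons s (foldr red_cons u z)"
  by (cases u) (auto simp: red_cons_red_cons distinct_adj_foldr_red_cons)

text \<open>A word acts on normal forms letter by letter, each letter as an involution.
  Associativity says that reducing a word does not change its action.\<close>

lemma foldr_red_cons_assoc:
  "distinct_adj z \<Longrightarrow>
    foldr red_cons (foldr red_cons x y) z = foldr red_cons x (foldr red_cons y z)"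
  by (induction x) (auto simp: foldr_red_cons_red_cons)

lemma foldr_red_cons_Nil: "distinct_adj x \<Longrightarrow> foldr red_cons x [] = x"
proof (induction x)
  case (Cons a x)
  then show ?case
    by (cases x) auto
qed simp

lemma foldr_red_cons_rev_append: "foldr red_cons (rev x @ x) [] = []"
proof -
  have "foldr red_cons (rev x @ x) y = y" if "distinct_adj y" for y
    using that by (induction x arbitrary: y)
      (simp_all add: red_cons_red_cons distinct_adj_foldr_red_cons)
  then show ?thesis
    by simp
qed

lemma group_free_prod_Z2: "group (free_prod_Z2 n)"
proof (rule groupI)
  fix x assume x: "x \<in> carrier (free_prod_Z2 n)"
  then have "foldr red_cons (rev x) x = []"
    using foldr_red_cons_rev_append[of x] by (simp add: free_prod_Z2_def foldr_red_cons_Nil)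
  with x show "\<exists>y\<in>carrier (free_prod_Z2 n). y \<otimes>\<^bsub>free_prod_Z2 n\<^esub> x = \<one>\<^bsub>free_prod_Z2 n\<^esub>"
    by (intro bexI[of _ "rev x"]) (auto simp: free_prod_Z2_def)
next
  fix x y assume "x \<in> carrier (free_prod_Z2 n)" "y \<in> carrier (free_prod_Z2 n)"
  then show "x \<otimes>\<^bsub>free_prod_Z2 n\<^esub> y \<in> carrier (free_prod_Z2 n)"
    using set_foldr_red_cons[of x y] by (auto simp: free_prod_Z2_def distinct_adj_foldr_red_cons)
qed (auto simp: free_prod_Z2_def foldr_red_cons_assoc)

section \<open>Wreath products and switch-walk-switch generators\<close>

lemma carrier_wreath:
  assumes "group H"
  shows "carrier (wreath H F) = {(\<phi>, x). \<phi> \<in> carrier F \<rightarrow>\<^sub>E carrier H \<and>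
    finite {z \<in> carrier F. \<phi> z \<noteq> \<one>\<^bsub>H\<^esub>} \<and> x \<in> carrier F}"
  using assms by (auto simp: wreath_def carrier_sum_group)

lemma mult_wreath:
  "(\<phi>, x) \<otimes>\<^bsub>wreath H F\<^esub> (\<psi>, y) =
    ((\<lambda>z\<in>carrier F. \<phi> z \<otimes>\<^bsub>H\<^esub> \<psi> (inv\<^bsub>F\<^esub> x \<otimes>\<^bsub>F\<^esub> z)), x \<otimes>\<^bsub>F\<^esub> y)"
  by (auto simp: wreath_def intro!: restrict_ext)

lemma one_wreath: "\<one>\<^bsub>wreath H F\<^esub> = ((\<lambda>z\<in>carrier F. \<one>\<^bsub>H\<^esub>), \<one>\<^bsub>F\<^esub>)"
  by (simp add: wreath_def)

lemma finite_translated_support: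
  assumes "group F" "x \<in> carrier F" "finite {z \<in> carrier F. P z}"
  shows "finite {z \<in> carrier F. P (x \<otimes>\<^bsub>F\<^esub> z)}"
proof -
  interpret F: group F by fact
  have "{z \<in> carrier F. P (x \<otimes>\<^bsub>F\<^esub> z)} \<subseteq> (\<lambda>z. inv\<^bsub>F\<^esub> x \<otimes>\<^bsub>F\<^esub> z) ` {z \<in> carrier F. P z}"
  proof
    fix z assume "z \<in> {z \<in> carrier F. P (x \<otimes>\<^bsub>F\<^esub> z)}"
    then show "z \<in> (\<lambda>z. inv\<^bsub>F\<^esub> x \<otimes>\<^bsub>F\<^esub> z) ` {z \<in> carrier F. P z}"
      using assms(2) by (intro image_eqI[of _ _ "x \<otimes>\<^bsub>F\<^esub> z"]) (auto simp: F.m_assoc[symmetric])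
  qed
  then show ?thesis
    using assms(3) finite_surj by blast
qed

lemma group_wreath:
  assumes "group H" "group F"
  shows "group (wreath H F)"
proof -
  interpret H: group H by fact
  interpret F: group F by fact
  note carr = carrier_wreath[OF \<open>group H\<close>, of F]
  show ?thesis
  proof (rule groupI)
    fix a b assume "a \<in> carrier (wreath H F)" "b \<in> carrier (wreath H F)"
    moreover obtain \<phi> x \<psi> y where ab: "a = (\<phi>, x)" "b = (\<psi>, y)"
      by (metis surj_pair)
    ultimately have *: "\<phi> \<in> carrier F \<rightarrow>\<^sub>E carrier H" "finite {z \<in> carrier F. \<phi> z \<noteq> \<one>\<^bsub>H\<^esub>}" "x \<in> carrier F"
      "\<psi> \<in> carrier F \<rightarrow>\<^sub>E carrier H" "finite {z \<in> carrier F. \<psi> z \<noteq> \<one>\<^bsub>H\<^esub>}" "y \<in> carrier F"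
      by (auto simp: carr)
    have "finite {z \<in> carrier F. \<phi> z \<otimes>\<^bsub>H\<^esub> \<psi> (inv\<^bsub>F\<^esub> x \<otimes>\<^bsub>F\<^esub> z) \<noteq> \<one>\<^bsub>H\<^esub>}"
      by (rule finite_subset[OF _ finite_UnI[OF *(2)
            finite_translated_support[OF \<open>group F\<close> F.inv_closed[OF *(3)] *(5)]]]) auto
    then have "finite {z \<in> carrier F. (\<lambda>z\<in>carrier F. \<phi> z \<otimes>\<^bsub>H\<^esub> \<psi> (inv\<^bsub>F\<^esub> x \<otimes>\<^bsub>F\<^esub> z)) z \<noteq> \<one>\<^bsub>H\<^esub>}"
      by (rule finite_subset[rotated]) auto
    moreover have "(\<lambda>z\<in>carrier F. \<phi> z \<otimes>\<^bsub>H\<^esub> \<psi> (inv\<^bsub>F\<^esub> x \<otimes>\<^bsub>F\<^esub> z)) \<in> carrier F \<rightarrow>\<^sub>E carrier H"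
      using * by (intro restrict_PiE_iff[THEN iffD2] ballI H.m_closed) (auto intro: PiE_mem)
    ultimately show "a \<otimes>\<^bsub>wreath H F\<^esub> b \<in> carrier (wreath H F)"
      using * unfolding ab mult_wreath carr by blast
  next
    show "\<one>\<^bsub>wreath H F\<^esub> \<in> carrier (wreath H F)"
      by (auto simp: carr one_wreath)
  next
    fix a b c assume "a \<in> carrier (wreath H F)" "b \<in> carrier (wreath H F)" "c \<in> carrier (wreath H F)"
    moreover obtain \<phi> x \<psi> y \<chi> z where abc: "a = (\<phi>, x)" "b = (\<psi>, y)" "c = (\<chi>, z)"
      by (metis surj_pair)
    ultimately have *: "\<phi> \<in> carrier F \<rightarrow>\<^sub>E carrier H" "x \<in> carrier F" "\<psi> \<in> carrier F \<rightarrow>\<^sub>E carrier H" "y \<in> carrier F"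
       "\<chi> \<in> carrier F \<rightarrow>\<^sub>E carrier H" "z \<in> carrier F"
      by (auto simp: carr)
    have [simp]: "\<phi> u \<in> carrier H" "\<psi> u \<in> carrier H" "\<chi> u \<in> carrier H" if "u \<in> carrier F" for u
      using that * by (auto intro: PiE_mem)
    show "a \<otimes>\<^bsub>wreath H F\<^esub> b \<otimes>\<^bsub>wreath H F\<^esub> c = a \<otimes>\<^bsub>wreath H F\<^esub> (b \<otimes>\<^bsub>wreath H F\<^esub> c)"
      unfolding abc mult_wreath using *(2,4,6)
      by (auto simp: F.m_assoc F.inv_mult_group H.m_assoc intro!: restrict_ext)
  next
    fix a assume "a \<in> carrier (wreath H F)"
    then obtain \<phi> x where a: "a = (\<phi>, x)" and *: "\<phi> \<in> carrier F \<rightarrow>\<^sub>E carrier H" "x \<in> carrier F"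
      by (auto simp: carr)
    have [simp]: "\<And>u. u \<in> carrier F \<Longrightarrow> \<phi> u \<in> carrier H"
      and [simp]: "\<And>u. u \<notin> carrier F \<Longrightarrow> \<phi> u = undefined"
      using * by (auto intro: PiE_mem PiE_arb)
    show "\<one>\<^bsub>wreath H F\<^esub> \<otimes>\<^bsub>wreath H F\<^esub> a = a"
      using *(2) unfolding a one_wreath mult_wreath by (auto intro!: ext)
  next
    fix a assume "a \<in> carrier (wreath H F)"
    then obtain \<phi> x where a: "a = (\<phi>, x)" and *: "\<phi> \<in> carrier F \<rightarrow>\<^sub>E carrier H" "x \<in> carrier F"
        "finite {z \<in> carrier F. \<phi> z \<noteq> \<one>\<^bsub>H\<^esub>}"
      by (auto simp: carr)
    \<comment> \<open>Left multiplication by \<open>(\<psi>, inv x)\<close> brings the value of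
      \<open>\<phi>\<close> at \<open>x \<otimes> z\<close> to \<open>z\<close>, so the inverse lamp
      is read off there.\<close>
    define \<psi> where "\<psi> = (\<lambda>z\<in>carrier F. inv\<^bsub>H\<^esub> \<phi> (x \<otimes>\<^bsub>F\<^esub> z))"
    have [simp]: "\<phi> u \<in> carrier H" if "u \<in> carrier F" for u
      using that * by (auto intro: PiE_mem)
    have "{z \<in> carrier F. \<psi> z \<noteq> \<one>\<^bsub>H\<^esub>} \<subseteq> {z \<in> carrier F. \<phi> (x \<otimes>\<^bsub>F\<^esub> z) \<noteq> \<one>\<^bsub>H\<^esub>}"
      by (auto simp: \<psi>_def)
    then have "finite {z \<in> carrier F. \<psi> z \<noteq> \<one>\<^bsub>H\<^esub>}"
      using finite_translated_support[OF \<open>group F\<close> *(2,3)] finite_subset by blast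
    moreover have "\<psi> \<in> carrier F \<rightarrow>\<^sub>E carrier H"
      using * unfolding \<psi>_def by (auto simp: PiE_mem)
    moreover have "(\<psi>, inv\<^bsub>F\<^esub> x) \<otimes>\<^bsub>wreath H F\<^esub> a = \<one>\<^bsub>wreath H F\<^esub>"
      unfolding a one_wreath mult_wreath using *(2)
      by (auto simp: \<psi>_def intro!: restrict_ext)
    ultimately show "\<exists>b\<in>carrier (wreath H F). b \<otimes>\<^bsub>wreath H F\<^esub> a = \<one>\<^bsub>wreath H F\<^esub>"
      using *(2) by (intro bexI[of _ "(\<psi>, inv\<^bsub>F\<^esub> x)"]) (simp_all add: carr)
  qed
qed

text \<open>The cursor \<open>x\<close> translates the second factor, so a switch placed at the
  identity takes effect at \<open>x\<close>.\<close>

lemma wreath_mult_delta_e: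
  assumes "group H" "group F" "(\<phi>, x) \<in> carrier (wreath H F)" "h \<in> carrier H"
  shows "(\<phi>, x) \<otimes>\<^bsub>wreath H F\<^esub> (delta_e H F h, \<one>\<^bsub>F\<^esub>) = (\<phi>(x := \<phi> x \<otimes>\<^bsub>H\<^esub> h), x)"
proof -
  interpret H: group H by fact
  interpret F: group F by fact
  have *: "\<phi> \<in> carrier F \<rightarrow>\<^sub>E carrier H" "x \<in> carrier F"
    using assms by (auto simp: carrier_wreath)
  have eq: "inv\<^bsub>F\<^esub> x \<otimes>\<^bsub>F\<^esub> z = \<one>\<^bsub>F\<^esub> \<longleftrightarrow> z = x" if "z \<in> carrier F" for z
    using that * F.inv_solve_left'[of "\<one>\<^bsub>F\<^esub>" x z] by auto
  have mem [simp]: "\<And>u. u \<in> carrier F \<Longrightarrow> \<phi> u \<in> carrier H"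
    and arb [simp]: "\<And>u. u \<notin> carrier F \<Longrightarrow> \<phi> u = undefined"
    using * by (auto intro: PiE_mem PiE_arb)
  show ?thesis
    using *(2) assms(4) eq unfolding mult_wreath
    by (auto simp: delta_e_def intro!: ext)
qed

lemma wreath_mult_one:
  assumes "group H" "group F" "(\<phi>, x) \<in> carrier (wreath H F)" "s \<in> carrier F"
  shows "(\<phi>, x) \<otimes>\<^bsub>wreath H F\<^esub> (\<one>\<^bsub>sum_group (carrier F) (\<lambda>_. H)\<^esub>, s) = (\<phi>, x \<otimes>\<^bsub>F\<^esub> s)"
proof -
  interpret H: group H by fact
  interpret F: group F by fact
  have *: "\<phi> \<in> carrier F \<rightarrow>\<^sub>E carrier H" "x \<in> carrier F"
    using assms by (auto simp: carrier_wreath)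
  have mem [simp]: "\<And>u. u \<in> carrier F \<Longrightarrow> \<phi> u \<in> carrier H"
    and arb [simp]: "\<And>u. u \<notin> carrier F \<Longrightarrow> \<phi> u = undefined"
    using * by (auto intro: PiE_mem PiE_arb)
  show ?thesis
    using *(2) unfolding mult_wreath by (auto intro!: ext)
qed

lemma delta_e_in_carrier_wreath:
  assumes "group H" "group F" "h \<in> carrier H"
  shows "(delta_e H F h, \<one>\<^bsub>F\<^esub>) \<in> carrier (wreath H F)"
proof -
  interpret H: group H by fact
  interpret F: group F by fact
  have "{z \<in> carrier F. delta_e H F h z \<noteq> \<one>\<^bsub>H\<^esub>} \<subseteq> {\<one>\<^bsub>F\<^esub>}"
    by (auto simp: delta_e_def)
  then have "finite {z \<in> carrier F. delta_e H F h z \<noteq> \<one>\<^bsub>H\<^esub>}"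
    using finite_subset by blast
  then show ?thesis
    using assms by (auto simp: carrier_wreath delta_e_def)
qed

lemma walk_in_carrier_wreath:
  assumes "group H" "s \<in> carrier F"
  shows "(\<one>\<^bsub>sum_group (carrier F) (\<lambda>_. H)\<^esub>, s) \<in> carrier (wreath H F)"
proof -
  interpret H: group H by fact
  show ?thesis
    using assms by (auto simp: carrier_wreath)
qed

lemma sws_gens_subset:
  assumes "group H" "group F" "S \<subseteq> carrier F"
  shows "sws_gens H F S \<subseteq> carrier (wreath H F)"
proof -
  interpret W: group "wreath H F"
    using assms group_wreath by blast
  show ?thesis
    using assms unfolding sws_gens_def
    by (auto intro!: W.m_closed delta_e_in_carrier_wreath walk_in_carrier_wreath simp del: one_sum_group)
qed

text \<open>The lamplighter move. The second switch acts on the already updated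
  \<open>\<psi>\<close>, which keeps the formula true even if the walk does not leave
  \<open>x\<close>.\<close>

lemma wreath_mult_sws_gen:
  assumes "group H" "group F" "(\<phi>, x) \<in> carrier (wreath H F)"
    and "h1 \<in> carrier H" "h2 \<in> carrier H" "s \<in> carrier F"
  shows "(\<phi>, x) \<otimes>\<^bsub>wreath H F\<^esub> ((delta_e H F h1, \<one>\<^bsub>F\<^esub>) \<otimes>\<^bsub>wreath H F\<^esub>
      (\<one>\<^bsub>sum_group (carrier F) (\<lambda>_. H)\<^esub>, s) \<otimes>\<^bsub>wreath H F\<^esub> (delta_e H F h2, \<one>\<^bsub>F\<^esub>)) =
    (let \<psi> = \<phi>(x := \<phi> x \<otimes>\<^bsub>H\<^esub> h1); y = x \<otimes>\<^bsub>F\<^esub> s in (\<psi>(y := \<psi> y \<otimes>\<^bsub>H\<^esub> h2), y))"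
proof -
  interpret W: group "wreath H F"
    using assms group_wreath by blast
  let ?D1 = "(delta_e H F h1, \<one>\<^bsub>F\<^esub>)" and ?W = "(\<one>\<^bsub>sum_group (carrier F) (\<lambda>_. H)\<^esub>, s)"
    and ?D2 = "(delta_e H F h2, \<one>\<^bsub>F\<^esub>)"
  have closed: "?D1 \<in> carrier (wreath H F)" "?W \<in> carrier (wreath H F)" "?D2 \<in> carrier (wreath H F)"
    using assms by (auto intro!: delta_e_in_carrier_wreath walk_in_carrier_wreath simp del: one_sum_group)
  let ?\<psi> = "\<phi>(x := \<phi> x \<otimes>\<^bsub>H\<^esub> h1)"
  have 1: "(\<phi>, x) \<otimes>\<^bsub>wreath H F\<^esub> ?D1 = (?\<psi>, x)"
    by (rule wreath_mult_delta_e[OF assms(1-4)])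
  have 2: "(?\<psi>, x) \<in> carrier (wreath H F)"
    using W.m_closed[OF assms(3) closed(1)] unfolding 1 .
  have 3: "(?\<psi>, x) \<otimes>\<^bsub>wreath H F\<^esub> ?W = (?\<psi>, x \<otimes>\<^bsub>F\<^esub> s)"
    by (rule wreath_mult_one[OF assms(1,2) 2 assms(6)])
  have 4: "(?\<psi>, x \<otimes>\<^bsub>F\<^esub> s) \<in> carrier (wreath H F)"
    using W.m_closed[OF 2 closed(2)] unfolding 3 .
  have "(\<phi>, x) \<otimes>\<^bsub>wreath H F\<^esub> (?D1 \<otimes>\<^bsub>wreath H F\<^esub> ?W \<otimes>\<^bsub>wreath H F\<^esub> ?D2) =
      (?\<psi>, x \<otimes>\<^bsub>F\<^esub> s) \<otimes>\<^bsub>wreath H F\<^esub> ?D2"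
    using closed assms(3) by (simp only: W.m_assoc[symmetric] W.m_closed 1 3)
  then show ?thesis
    by (simp only: wreath_mult_delta_e[OF assms(1,2) 4 assms(5)] Let_def)
qed

section \<open>The tree\<close>

lemma permutesI:
  assumes "\<And>x. x \<in> S \<Longrightarrow> f x \<in> S" "\<And>x. x \<in> S \<Longrightarrow> g x \<in> S"
    and "\<And>x. x \<in> S \<Longrightarrow> g (f x) = x" "\<And>x. x \<in> S \<Longrightarrow> f (g x) = x"
    and "\<And>x. x \<notin> S \<Longrightarrow> f x = x"
  shows "f permutes S"
proof (rule bij_imp_permutes)
  show "bij_betw f S S"
    using assms by (intro bij_betw_byWitness[of S g f]) auto
qed (use assms in auto)

text \<open>The vertex \<open>om j\<close> is \<open>\<omega>(j)\<close>; negative \<open>j\<close> continue the ray downwards along zero children.\<close>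

definition om :: "int \<Rightarrow> vertex" where
  "om j = (- j, \<lambda>_. 0)"

lemma omega_ray_eq_om: "omega_ray n = om (int n)"
  and origin_eq_om: "origin = om 0"
  by (simp_all add: omega_ray_def origin_def om_def)

lemma fst_ancestor [simp]: "fst (ancestor v) = fst v - 1"
  and fst_child [simp]: "fst (child v t) = fst v + 1"
  and fst_om [simp]: "fst (om j) = - j"
  by (simp_all add: ancestor_def child_def om_def)

lemma om_inject [simp]: "om i = om j \<longleftrightarrow> i = j"
  by (simp add: om_def)

lemma ancestor_om [simp]: "ancestor (om j) = om (j + 1)"
  by (simp add: om_def ancestor_def fun_eq_iff)

lemma child_om [simp]: "child (om j) 0 = om (j - 1)"
  by (simp add: om_def child_def fun_eq_iff)

lemma funpow_ancestor:
  "(ancestor ^^ n) v =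
    (fst v - int n, \<lambda>k. if fst v - int n < k \<and> k \<le> fst v then 0 else snd v k)"
  by (induction n) (auto simp: ancestor_def fun_eq_iff prod_eq_iff)

locale tree =
  fixes q :: nat
  assumes q_ge_2: "2 \<le> q"
begin

lemma verts_iff:
  "v \<in> verts q \<longleftrightarrow>
    (\<forall>k. snd v k < q) \<and> (\<forall>k>fst v. snd v k = 0) \<and> (\<exists>N. \<forall>k<N. snd v k = 0)"
  by (cases v) (auto simp: verts_def level_def)

lemma ancestor_in_verts [simp]: "v \<in> verts q \<Longrightarrow> ancestor v \<in> verts q"
  using q_ge_2 by (auto simp: verts_iff ancestor_def)

lemma child_in_verts [simp]:
  assumes "v \<in> verts q" "t < q"
  shows "child v t \<in> verts q"
proof -
  from assms obtain N where "\<forall>k<N. snd v k = 0"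
    by (auto simp: verts_iff)
  then have "\<forall>k<min N (fst v). snd (child v t) k = 0"
    by (auto simp: child_def)
  moreover have "(\<forall>k. snd (child v t) k < q) \<and> (\<forall>k>fst (child v t). snd (child v t) k = 0)"
    using assms by (auto simp: child_def verts_iff)
  ultimately show ?thesis
    unfolding verts_iff by blast
qed

lemma om_in_verts [simp]: "om j \<in> verts q"
  using q_ge_2 by (auto simp: verts_iff om_def)

lemma origin_in_verts [simp]: "origin \<in> verts q"
  by (simp add: origin_eq_om)

lemma ancestor_child [simp]: "v \<in> verts q \<Longrightarrow> ancestor (child v t) = v"
  by (cases v) (auto simp: verts_iff ancestor_def child_def)

definition label :: "vertex \<Rightarrow> nat" where
  "label v = snd v (fst v)"

lemma label_less [simp]: "v \<in> verts q \<Longrightarrow> label v < q"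
  by (simp add: label_def verts_iff)

lemma label_child [simp]: "label (child v t) = t"
  by (simp add: label_def child_def)

lemma child_ancestor [simp]: "v \<in> verts q \<Longrightarrow> child (ancestor v) (label v) = v"
  by (cases v) (simp add: ancestor_def child_def label_def)

lemma child_inject:
  "v \<in> verts q \<Longrightarrow> w \<in> verts q \<Longrightarrow> child v s = child w t \<longleftrightarrow> v = w \<and> s = t"
  by (metis ancestor_child label_child)

lemma funpow_ancestor_in_verts: "v \<in> verts q \<Longrightarrow> (ancestor ^^ n) v \<in> verts q"
  by (induction n) auto

lemma funpow_ancestor_eq_om:
  assumes "v \<in> verts q"
  shows "\<exists>N. \<forall>n\<ge>N. (ancestor ^^ n) v = om (int n - fst v)"
proof -
  from assms obtain N where N: "\<forall>k<N. snd v k = 0" "\<forall>k>fst v. snd v k = 0"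
    by (auto simp: verts_iff)
  \<comment> \<open>The bound puts the height \<open>fst v - n\<close> below \<open>N\<close>, so
    every entry that survives the truncation lies in the zero tail.\<close>
  have "(ancestor ^^ n) v = om (int n - fst v)" if "n \<ge> nat (fst v - N + 1)" for n
    using that N by (auto simp: funpow_ancestor om_def fun_eq_iff not_le not_less)
  then show ?thesis
    by blast
qed

text \<open>Every vertex descends from vertices arbitrarily far up the ray to \<omega>. The
  threshold \<open>J\<close> is free because an automorphism is at first understood only on a tail
  of that ray.\<close>

lemma verts_induct [consumes 1, case_names om child]:
  assumes v: "v \<in> verts q"
    and om: "\<And>j. j \<ge> J \<Longrightarrow> P (om j)"
    and child: "\<And>v t. v \<in> verts q \<Longrightarrow> t < q \<Longrightarrow> P v \<Longrightarrow> P (child v t)"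
  shows "P v"
proof -
  have descend: "P w" if "P ((ancestor ^^ n) w)" "w \<in> verts q" for n w
    using that
  proof (induction n arbitrary: w)
    case (Suc n)
    then have "P (ancestor w)"
      by (simp add: funpow_swap1)
    then show ?case
      using child[of "ancestor w" "label w"] Suc.prems by simp
  qed simp
  obtain N where N: "\<forall>n\<ge>N. (ancestor ^^ n) v = om (int n - fst v)"
    using funpow_ancestor_eq_om[OF v] by blast
  then have "P ((ancestor ^^ max N (nat (J + fst v))) v)"
    by (simp add: om)
  then show ?thesis
    using descend v by blast
qed

text \<open>The ancestors of \<open>p\<close> run into the ray to \<omega>, from whose tail every
  vertex is reached downwards.\<close>

lemma verts_connected [consumes 2, case_names base ancestor child]:
  assumes p: "p \<in> verts q" and v: "v \<in> verts q"
    and base: "P p"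
    and anc: "\<And>v. v \<in> verts q \<Longrightarrow> P v \<Longrightarrow> P (ancestor v)"
    and child: "\<And>v t. v \<in> verts q \<Longrightarrow> t < q \<Longrightarrow> P v \<Longrightarrow> P (child v t)"
  shows "P v"
proof -
  obtain N where N: "\<forall>n\<ge>N. (ancestor ^^ n) p = om (int n - fst p)"
    using funpow_ancestor_eq_om[OF p] by blast
  have "P ((ancestor ^^ n) p)" for n
    by (induction n) (auto simp: base anc funpow_ancestor_in_verts p)
  then have *: "P (om (int n - fst p))" if "n \<ge> N" for n
    using N that by metis
  have "P (om j)" if "j \<ge> int N - fst p" for j
    using *[of "nat (j + fst p)"] that by simp
  with v show ?thesis
    by (rule verts_induct[where P = P]) (auto intro: child)
qed


section \<open>Affine automorphisms\<close>

lemma mult_Aff [simp]: "g \<otimes>\<^bsub>Aff q\<^esub> h = h \<circ> g"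
  and one_Aff [simp]: "\<one>\<^bsub>Aff q\<^esub> = id"
  by (simp_all add: Aff_def)

lemma omega_ray_in_end: "omega_ray \<in> end_of q omega_ray"
proof -
  have "omega_ray \<in> rays q"
    by (auto simp: rays_def adj_def omega_ray_eq_om inj_def)
  then show ?thesis
    unfolding end_of_def by blast
qed

text \<open>Adjacency alone leaves open which neighbour becomes the ancestor. Far up the ray the
  shift of its tail decides, and the decision descends: if a child of \<open>v\<close> went to the
  ancestor of \<open>g v\<close>, it would share its image with \<open>ancestor v\<close>, against
  injectivity.\<close>

lemma in_Aff_imp_commute:
  assumes g: "g permutes verts q"
    and adj: "\<forall>v\<in>verts q. \<forall>w\<in>verts q. adj q (g v) (g w) \<longleftrightarrow> adj q v w"
    and ray: "\<And>n. g (omega_ray (n + a)) = omega_ray (n + b)"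
    and v: "v \<in> verts q"
  shows "g (ancestor v) = ancestor (g v)"
  using v
proof (induction v rule: verts_induct[where J = "int a"])
  case (om j)
  define n where "n = nat (j - int a)"
  have "om j = omega_ray (n + a)" "om (j + 1) = omega_ray (Suc n + a)"
    using om by (simp_all add: n_def omega_ray_eq_om)
  then have "g (om j) = omega_ray (n + b)" "g (om (j + 1)) = omega_ray (Suc n + b)"
    by (simp_all only: ray)
  then show ?case
    by (simp add: omega_ray_eq_om)
next
  case (child v t)
  have "adj q (g (child v t)) (g v)"
    using adj child by (simp add: adj_def)
  then consider "ancestor (g (child v t)) = g v" | "ancestor (g v) = g (child v t)"
    unfolding adj_def by blast
  then show ?case
  proof cases
    case 2
    then have "g (ancestor v) = g (child v t)"
      using child by simp
    then have "ancestor v = child v t"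
      using inj_eq[OF permutes_inj[OF g]] by blast
    then have "fst (ancestor v) = fst (child v t)"
      by simp
    then show ?thesis
      by simp
  qed (use child in simp)
qed

lemma commute_imp_in_Aff:
  assumes g: "g permutes verts q"
    and anc: "\<And>v. v \<in> verts q \<Longrightarrow> g (ancestor v) = ancestor (g v)"
    and ray: "\<And>n. g (omega_ray (n + a)) = omega_ray (n + b)"
  shows "g \<in> carrier (Aff q)"
proof -
  have inj: "g v = g w \<longleftrightarrow> v = w" for v w
    by (rule inj_eq[OF permutes_inj[OF g]])
  have in_verts: "g v \<in> verts q \<longleftrightarrow> v \<in> verts q" for v
    using permutes_in_image[OF g] .
  have adj: "adj q (g v) (g w) \<longleftrightarrow> adj q v w" for v w
    by (auto simp: adj_def in_verts anc[symmetric] inj)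
  define h where "h = inv_into UNIV g"
  have gh: "g (h v) = v" and hg: "h (g v) = v" for v
    using permutes_inverses[OF g] by (simp_all add: h_def)
  have "adj q (h v) (h w) \<longleftrightarrow> adj q v w" for v w
    using adj[of "h v" "h w"] by (simp add: gh)
  moreover have "inj h"
    using gh by (metis injI)
  ultimately have h_rays: "h \<circ> r \<in> rays q" if "r \<in> rays q" for r
    using that by (auto simp: rays_def intro: inj_compose)
  have g_rays: "g \<circ> r \<in> rays q" if "r \<in> rays q" for r
    using that adj permutes_inj[OF g] by (auto simp: rays_def intro: inj_compose)
  have "g \<circ> r \<in> end_of q omega_ray" if r: "r \<in> end_of q omega_ray" for r
  proof -
    obtain a' b' where "\<And>n. r (n + a') = omega_ray (n + b')"
      using r by (auto simp: end_of_def)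
    then have "(g \<circ> r) (n + (a + a')) = omega_ray (n + (b + b'))" for n
      using ray[of "n + b'"] by (simp add: add.assoc[symmetric]) (metis add.assoc add.commute)
    then show ?thesis
      using g_rays r unfolding end_of_def by blast
  qed
  moreover have "r \<in> (\<lambda>r. g \<circ> r) ` end_of q omega_ray" if r: "r \<in> end_of q omega_ray" for r
  proof
    show "r = g \<circ> (h \<circ> r)"
      by (simp add: fun_eq_iff gh)
    obtain a' b' where "\<And>n. r (n + a') = omega_ray (n + b')"
      using r by (auto simp: end_of_def)
    moreover have "h (omega_ray (n + b)) = omega_ray (n + a)" for n
      by (metis ray hg)
    ultimately have "(h \<circ> r) (n + (b + a')) = omega_ray (n + (a + b'))" for n
      by simp (metis add.assoc add.commute)
    then show "h \<circ> r \<in> end_of q omega_ray"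
      using h_rays r unfolding end_of_def by blast
  qed
  ultimately have "(\<lambda>r. g \<circ> r) ` end_of q omega_ray = end_of q omega_ray"
    by blast
  then show ?thesis
    using g adj by (simp add: Aff_def)
qed

text \<open>The workable form of the group: fixing \<omega> becomes a shift of a tail of
  \<open>omega_ray\<close>. Two natural offsets are kept since the shift may go either way.\<close>

lemma Aff_iff:
  "g \<in> carrier (Aff q) \<longleftrightarrow> g permutes verts q \<and>
    (\<forall>v\<in>verts q. g (ancestor v) = ancestor (g v)) \<and>
    (\<exists>a b. \<forall>n. g (omega_ray (n + a)) = omega_ray (n + b))"
proof
  assume g: "g \<in> carrier (Aff q)"
  then have "g \<circ> omega_ray \<in> end_of q omega_ray"
    using omega_ray_in_end by (auto simp: Aff_def)
  then obtain a b where "\<And>n. g (omega_ray (n + a)) = omega_ray (n + b)"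
    by (auto simp: end_of_def)
  with g in_Aff_imp_commute[of g a b] show "g permutes verts q \<and>
    (\<forall>v\<in>verts q. g (ancestor v) = ancestor (g v)) \<and>
    (\<exists>a b. \<forall>n. g (omega_ray (n + a)) = omega_ray (n + b))"
    unfolding Aff_def by auto
qed (auto intro: commute_imp_in_Aff)

lemma Aff_permutes: "g \<in> carrier (Aff q) \<Longrightarrow> g permutes verts q"
  by (simp add: Aff_iff)

lemma Aff_in_verts [simp]: "g \<in> carrier (Aff q) \<Longrightarrow> g v \<in> verts q \<longleftrightarrow> v \<in> verts q"
  by (meson Aff_permutes permutes_in_image)

lemma Aff_inject: "g \<in> carrier (Aff q) \<Longrightarrow> g v = g w \<longleftrightarrow> v = w"
  by (meson Aff_permutes permutes_inj inj_eq)

lemma Aff_ancestor: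
  "g \<in> carrier (Aff q) \<Longrightarrow> v \<in> verts q \<Longrightarrow> g (ancestor v) = ancestor (g v)"
  by (simp add: Aff_iff)

lemma inv_in_Aff:
  assumes "g \<in> carrier (Aff q)"
  shows "inv_into UNIV g \<in> carrier (Aff q)"
proof -
  let ?h = "inv_into UNIV g"
  note g = assms[unfolded Aff_iff]
  have gh: "g (?h v) = v" and hg: "?h (g v) = v" for v
    using permutes_inverses[OF Aff_permutes[OF assms]] by simp_all
  have perm: "?h permutes verts q"
    using g permutes_inv by blast
  have "?h (ancestor v) = ancestor (?h v)" if "v \<in> verts q" for v
    using Aff_ancestor[OF assms, of "?h v"] that permutes_in_image[OF perm, of v] gh hg
    by metis
  moreover obtain a b where "\<And>n. g (omega_ray (n + a)) = omega_ray (n + b)"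
    using g by blast
  then have "?h (omega_ray (n + b)) = omega_ray (n + a)" for n
    by (metis hg)
  ultimately show ?thesis
    using perm unfolding Aff_iff by blast
qed

lemma group_Aff: "group (Aff q)"
proof (rule groupI)
  fix g h assume g: "g \<in> carrier (Aff q)" and h: "h \<in> carrier (Aff q)"
  obtain a b where ab: "\<And>n. g (omega_ray (n + a)) = omega_ray (n + b)"
    using g by (auto simp: Aff_iff)
  obtain a' b' where ab': "\<And>n. h (omega_ray (n + a')) = omega_ray (n + b')"
    using h by (auto simp: Aff_iff)
  have "(h \<circ> g) (omega_ray (n + (a + a'))) = omega_ray (n + (b + b'))" for n
    using ab[of "n + a'"] ab'[of "n + b"] by (simp add: ac_simps)
  then show "g \<otimes>\<^bsub>Aff q\<^esub> h \<in> carrier (Aff q)"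
    using g h by (auto intro!: commute_imp_in_Aff permutes_compose
        simp: Aff_permutes Aff_ancestor)
next
  show "\<one>\<^bsub>Aff q\<^esub> \<in> carrier (Aff q)"
    by (auto simp: Aff_iff permutes_id)
next
  fix g assume "g \<in> carrier (Aff q)"
  then show "\<exists>h\<in>carrier (Aff q). h \<otimes>\<^bsub>Aff q\<^esub> g = \<one>\<^bsub>Aff q\<^esub>"
    by (intro bexI[of _ "inv_into UNIV g"]) (auto simp: inv_in_Aff permutes_inv_o(1)[OF Aff_permutes])
qed (auto simp: comp_assoc)

sublocale Aff: group "Aff q"
  by (rule group_Aff)

lemma comp_in_Aff:
  "g \<in> carrier (Aff q) \<Longrightarrow> h \<in> carrier (Aff q) \<Longrightarrow> h \<circ> g \<in> carrier (Aff q)"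
  using Aff.m_closed[of g h] by simp

lemma inv_Aff: "g \<in> carrier (Aff q) \<Longrightarrow> inv\<^bsub>Aff q\<^esub> g = inv_into UNIV g"
  by (intro Aff.inv_equality) (auto simp: inv_in_Aff permutes_inv_o(1)[OF Aff_permutes])

lemma fst_Aff:
  assumes g: "g \<in> carrier (Aff q)" and v: "v \<in> verts q"
  shows "fst (g v) = fst v + Phi g"
  using om_in_verts[of 0] v
proof (induction rule: verts_connected)
  case base
  then show ?case
    by (simp add: Phi_def height_def origin_eq_om)
next
  case (ancestor v)
  then show ?case
    by (simp add: Aff_ancestor[OF g])
next
  case (child v t)
  then have "fst (g v) = fst (g (child v t)) - 1"
    using Aff_ancestor[OF g, of "child v t"] by simp
  with child show ?case
    by simp
qed

lemma Phi_comp: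
  assumes "g \<in> carrier (Aff q)" "h \<in> carrier (Aff q)"
  shows "Phi (h \<circ> g) = Phi g + Phi h"
  using assms fst_Aff[of "h \<circ> g" "om 0"] fst_Aff[of h "g (om 0)"] fst_Aff[of g "om 0"]
  by (simp add: comp_in_Aff)

section \<open>The powers of \<alpha>\<close>

definition shift :: "int \<Rightarrow> vertex \<Rightarrow> vertex" where
  "shift m v = (if v \<in> verts q then (fst v + m, \<lambda>k. snd v (k - m)) else v)"

lemma alpha_eq_shift: "alpha q = shift 1"
  by (simp add: fun_eq_iff alpha_def shift_def)

lemma shift_in_verts [simp]: "v \<in> verts q \<Longrightarrow> shift m v \<in> verts q"
proof -
  assume v: "v \<in> verts q"
  then obtain N where "\<forall>k<N. snd v k = 0"
    by (auto simp: verts_iff)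
  then have "\<forall>k<N + m. snd (shift m v) k = 0"
    using v by (simp add: shift_def)
  moreover have "(\<forall>k. snd (shift m v) k < q) \<and> (\<forall>k>fst (shift m v). snd (shift m v) k = 0)"
    using v by (auto simp: shift_def verts_iff)
  ultimately show ?thesis
    unfolding verts_iff by blast
qed

lemma shift_add: "shift m (shift n v) = shift (n + m) v"
proof (cases "v \<in> verts q")
  case True
  then have "shift n v \<in> verts q"
    by simp
  with True show ?thesis
    by (simp add: shift_def fun_eq_iff algebra_simps)
qed (simp add: shift_def)

lemma shift_0 [simp]: "shift 0 v = v"
  by (simp add: shift_def)

lemma shift_om [simp]: "shift m (om j) = om (j - m)"
  by (simp add: shift_def) (simp add: om_def)

lemma shift_child: "v \<in> verts q \<Longrightarrow> t < q \<Longrightarrow> shift m (child v t) = child (shift m v) t"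
  using child_in_verts[of v t] by (auto simp: shift_def child_def fun_eq_iff)

lemma shift_in_Aff [simp]: "shift m \<in> carrier (Aff q)"
\<comment> \<open>\<open>shift m\<close> sends \<open>om j\<close> to \<open>om (j - m)\<close>, so
  the positive and negative parts of \<open>m\<close> serve as offsets.\<close>
proof (rule commute_imp_in_Aff[of _ "nat m" "nat (- m)"])
  show "shift m permutes verts q"
    by (rule permutesI[of _ _ "shift (- m)"]) (simp_all add: shift_add, simp add: shift_def)
  fix v assume v: "v \<in> verts q"
  then have "shift m v = child (shift m (ancestor v)) (label v)"
    using shift_child[of "ancestor v" "label v" m] by simp
  with v show "shift m (ancestor v) = ancestor (shift m v)"
    by simp
qed (simp add: omega_ray_eq_om)

lemma Phi_shift [simp]: "Phi (shift m) = m"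
  by (simp add: Phi_def height_def origin_eq_om)

lemma inv_shift: "inv\<^bsub>Aff q\<^esub> (shift m) = shift (- m)"
  by (intro Aff.inv_equality) (auto simp: shift_add)

lemma alpha_int_pow: "alpha q [^]\<^bsub>Aff q\<^esub> (m :: int) = shift m"
proof -
  have "alpha q [^]\<^bsub>Aff q\<^esub> n = shift (int n)" for n :: nat
    by (induction n) (auto simp: alpha_eq_shift shift_add ac_simps)
  then show ?thesis
    by (simp add: int_pow_def2 inv_shift)
qed


section \<open>Portraits\<close>

text \<open>Commuting with \<open>ancestor\<close> makes \<open>g\<close> send children of
  \<open>v\<close> to children of \<open>g v\<close>, so the labels give an injective self-map of a
  finite set. Being the identity outside \<open>{..<q}\<close> makes it unique as a
  function.\<close>

lemma ex1_portrait:
  assumes g: "g \<in> carrier (Aff q)" and v: "v \<in> verts q"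
  shows "\<exists>!\<sigma>. \<sigma> permutes {..<q} \<and> (\<forall>t<q. g (child v t) = child (g v) (\<sigma> t))"
proof
  define \<sigma> where "\<sigma> t = (if t < q then label (g (child v t)) else t)" for t
  have child: "g (child v t) = child (g v) (\<sigma> t)" if "t < q" for t
    using child_ancestor[of "g (child v t)"] Aff_ancestor[OF g, of "child v t"] that g v
    by (simp add: \<sigma>_def)
  have "inj_on \<sigma> {..<q}"
    by (intro inj_onI) (metis Aff_inject[OF g] child child_inject lessThan_iff v)
  moreover have "\<sigma> ` {..<q} \<subseteq> {..<q}"
    using g v by (auto simp: \<sigma>_def)
  ultimately have "bij_betw \<sigma> {..<q} {..<q}"
    by (simp add: bij_betw_def endo_inj_surj)
  then have "\<sigma> permutes {..<q}"
    by (rule bij_imp_permutes) (simp add: \<sigma>_def)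
  then show "\<sigma> permutes {..<q} \<and> (\<forall>t<q. g (child v t) = child (g v) (\<sigma> t))"
    using child by blast
  fix \<tau> assume \<tau>: "\<tau> permutes {..<q} \<and> (\<forall>t<q. g (child v t) = child (g v) (\<tau> t))"
  then show "\<tau> = \<sigma>"
    by (auto simp: fun_eq_iff \<sigma>_def permutes_def)
qed

text \<open>The exponent of \<alpha> is forced: horocyclic elements keep the height, so it must be
  \<open>Phi g\<close>.\<close>

lemma hor_part_eq:
  assumes g: "g \<in> carrier (Aff q)"
  shows "hor_part q g = shift (- Phi g) \<circ> g"
  unfolding hor_part_def alpha_int_pow
proof (rule the_equality)
  show "shift (- Phi g) \<circ> g \<in> Hor q \<and> (\<exists>m. g = (shift (- Phi g) \<circ> g) \<otimes>\<^bsub>Aff q\<^esub> shift m)"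
  proof
    show "shift (- Phi g) \<circ> g \<in> Hor q"
      using g by (simp add: Hor_def comp_in_Aff Phi_comp)
    show "\<exists>m. g = (shift (- Phi g) \<circ> g) \<otimes>\<^bsub>Aff q\<^esub> shift m"
      by (intro exI[of _ "Phi g"]) (simp add: fun_eq_iff shift_add)
  qed
  fix \<gamma> assume "\<gamma> \<in> Hor q \<and> (\<exists>m. g = \<gamma> \<otimes>\<^bsub>Aff q\<^esub> shift m)"
  then obtain m where \<gamma>: "\<gamma> \<in> carrier (Aff q)" "Phi \<gamma> = 0" "g = shift m \<circ> \<gamma>"
    by (auto simp: Hor_def)
  then have "Phi g = m"
    by (simp add: Phi_comp)
  with \<gamma> show "\<gamma> = shift (- Phi g) \<circ> g"
    by (simp add: fun_eq_iff shift_add)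
qed

text \<open>Shifts preserve the labels of children, so the portrait of the horocyclic part is also
  the local action of \<open>g\<close> itself.\<close>

lemma portrait_works:
  assumes g: "g \<in> carrier (Aff q)" and v: "v \<in> verts q"
  shows "portrait q g v permutes {..<q} \<and>
    (\<forall>t<q. g (child v t) = child (g v) (portrait q g v t))"
proof -
  let ?\<gamma> = "shift (- Phi g) \<circ> g"
  have \<sigma>: "portrait q g v permutes {..<q} \<and> (\<forall>t<q. ?\<gamma> (child v t) = child (?\<gamma> v) (portrait q g v t))"
    unfolding portrait_def hor_part_eq[OF g] hor_portrait_def
    by (rule theI'[OF ex1_portrait[of ?\<gamma> v]]) (simp_all add: g v comp_in_Aff)
  have "g (child v t) = child (g v) (portrait q g v t)" if t: "t < q" for t
  proof -
    have \<sigma>t: "portrait q g v t < q"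
      using \<sigma> t permutes_in_image[of "portrait q g v" "{..<q}" t] by simp
    have "g (child v t) = shift (Phi g) (?\<gamma> (child v t))"
      by (simp add: shift_add)
    also have "\<dots> = child (shift (Phi g) (?\<gamma> v)) (portrait q g v t)"
      using \<sigma> t g v \<sigma>t by (simp add: shift_child)
    finally show ?thesis
      by (simp add: shift_add)
  qed
  with \<sigma> show ?thesis
    by blast
qed

lemma portrait_permutes:
  "g \<in> carrier (Aff q) \<Longrightarrow> v \<in> verts q \<Longrightarrow> portrait q g v permutes {..<q}"
  using portrait_works by blast

lemma Aff_child:
  "g \<in> carrier (Aff q) \<Longrightarrow> v \<in> verts q \<Longrightarrow> t < q \<Longrightarrow>
    g (child v t) = child (g v) (portrait q g v t)"
  using portrait_works by blast

lemma portrait_eqI: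
  assumes "g \<in> carrier (Aff q)" "v \<in> verts q" "\<sigma> permutes {..<q}"
    and "\<And>t. t < q \<Longrightarrow> g (child v t) = child (g v) (\<sigma> t)"
  shows "portrait q g v = \<sigma>"
  using assms ex1_portrait[OF assms(1,2)] portrait_works[OF assms(1,2)] by blast

lemma hor_portrait_eq:
  assumes "g \<in> carrier (Aff q)" "v \<in> verts q"
  shows "hor_portrait q g v = portrait q g v"
  unfolding hor_portrait_def
  using assms by (intro the1_equality ex1_portrait portrait_works)

lemma portrait_less: "g \<in> carrier (Aff q) \<Longrightarrow> v \<in> verts q \<Longrightarrow> t < q \<Longrightarrow> portrait q g v t < q"
  using portrait_permutes permutes_in_image[of "portrait q g v" "{..<q}" t] by simp

text \<open>The chain rule: \<open>v\<close> has moved to \<open>g v\<close> when \<open>h\<close>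
  acts. If \<open>h\<close> has a nontrivial portrait only at the origin, only the vertex that
  \<open>g\<close> maps to the origin is affected.\<close>

lemma portrait_comp:
  assumes g: "g \<in> carrier (Aff q)" and h: "h \<in> carrier (Aff q)" and v: "v \<in> verts q"
  shows "portrait q (h \<circ> g) v = portrait q h (g v) \<circ> portrait q g v"
  using assms by (intro portrait_eqI)
    (auto simp: comp_in_Aff Aff_child portrait_less intro!: permutes_compose portrait_permutes)

lemma portrait_id: "v \<in> verts q \<Longrightarrow> portrait q id v = id"
  using Aff.one_closed by (intro portrait_eqI) (auto simp: permutes_id)

lemma portrait_shift [simp]: "v \<in> verts q \<Longrightarrow> portrait q (shift m) v = id"
  by (intro portrait_eqI) (auto simp: permutes_id shift_child)

text \<open>From one common value, commutation with \<open>ancestor\<close> determines the values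
  above and the portrait those below. The value matters, since all shifts have trivial
  portrait.\<close>

lemma Aff_eqI:
  assumes g: "g \<in> carrier (Aff q)" and h: "h \<in> carrier (Aff q)"
    and p: "p \<in> verts q" "g p = h p"
    and eq: "\<And>v. v \<in> verts q \<Longrightarrow> portrait q g v = portrait q h v"
  shows "g = h"
proof
  fix v show "g v = h v"
  proof (cases "v \<in> verts q")
    case True
    with p(1) show ?thesis
    proof (induction rule: verts_connected)
      case base
      show ?case
        by (rule p)
    next
      case (ancestor v)
      then show ?case
        by (simp add: Aff_ancestor[OF g] Aff_ancestor[OF h])
    next
      case (child v t)
      then show ?case
        by (simp add: Aff_child[OF g] Aff_child[OF h] eq)
    qed
  next
    case False
    then show ?thesis
      by (simp add: permutes_not_in[OF Aff_permutes[OF g]] permutes_not_in[OF Aff_permutes[OF h]])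
  qed
qed

section \<open>The elements \<open>delta_o\<close> in closed form\<close>

lemma Hor_fixes_om:
  assumes "g \<in> Hor q"
  shows "\<exists>a\<ge>0. \<forall>j\<ge>a. g (om j) = om j"
proof -
  have g: "g \<in> carrier (Aff q)" and Phi: "Phi g = 0"
    using assms by (auto simp: Hor_def)
  then obtain a b where ab: "\<And>n. g (omega_ray (n + a)) = omega_ray (n + b)"
    by (auto simp: Aff_iff)
  have "g (om j) = om j" if "j \<ge> int a" for j
  proof -
    define n where "n = nat (j - int a)"
    have j: "om j = omega_ray (n + a)"
      using that by (simp add: n_def omega_ray_eq_om)
    have "g (om j) = om (int (n + b))"
      unfolding j ab by (simp add: omega_ray_eq_om)
    with fst_Aff[OF g om_in_verts, of j] Phi show ?thesis
      by simp
  qed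
  then show ?thesis
    by (intro exI[of _ "int a"]) auto
qed

text \<open>The condition selects the vertices strictly below the origin; their entry with index 1
  names the child of the origin through which they descend. This is
  \<open>delta_o q \<sigma>\<close>, by \<open>delta_o_eq_twist\<close>.\<close>

definition twist :: "(nat \<Rightarrow> nat) \<Rightarrow> vertex \<Rightarrow> vertex" where
  "twist \<sigma> v = (if v \<in> verts q \<and> fst v \<ge> 1 \<and> (\<forall>k\<le>0. snd v k = 0)
     then (fst v, (snd v)(1 := \<sigma> (snd v 1))) else v)"

lemma twist_in_verts:
  assumes "\<sigma> permutes {..<q}" "v \<in> verts q"
  shows "twist \<sigma> v \<in> verts q"
proof (cases "fst v \<ge> 1 \<and> (\<forall>k\<le>0. snd v k = 0)")
  case True
  have "\<forall>k<1. snd (twist \<sigma> v) k = 0"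
    using True by (simp add: twist_def)
  moreover have "snd (twist \<sigma> v) k < q" for k
    using assms permutes_in_image[OF assms(1), of "snd v 1"] by (auto simp: twist_def verts_iff)
  moreover have "\<forall>k>fst (twist \<sigma> v). snd (twist \<sigma> v) k = 0"
    using True assms(2) by (auto simp: twist_def verts_iff)
  ultimately show ?thesis
    unfolding verts_iff by blast
next
  case False
  then have "twist \<sigma> v = v"
    by (auto simp: twist_def)
  then show ?thesis
    using assms(2) by simp
qed

lemma twist_twist:
  assumes "\<sigma> permutes {..<q}"
  shows "twist \<tau> (twist \<sigma> v) = twist (\<tau> \<circ> \<sigma>) v"
  using twist_in_verts[OF assms, of v] by (auto simp: twist_def)

lemma twist_id: "twist id v = v"
  by (simp add: twist_def)

lemma twist_om [simp]: "j \<ge> 0 \<Longrightarrow> twist \<sigma> (om j) = om j"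
  by (simp add: twist_def)

lemma twist_ancestor:
  assumes "v \<in> verts q"
  shows "twist \<sigma> (ancestor v) = ancestor (twist \<sigma> v)"
\<comment> \<open>From height 2 on, the twisted entry survives in the ancestor; at height 1 it is
  the entry deleted.\<close>
proof (cases "fst v \<ge> 2")
  case True
  with assms show ?thesis
    by (auto simp: twist_def) (auto simp: ancestor_def fun_eq_iff)
next
  case False
  with assms show ?thesis
    by (auto simp: twist_def) (auto simp: ancestor_def fun_eq_iff)
qed

lemma twist_in_Aff:
  assumes "\<sigma> permutes {..<q}"
  shows "twist \<sigma> \<in> carrier (Aff q)"
proof (rule commute_imp_in_Aff[of _ 0 0])
  let ?\<tau> = "inv_into UNIV \<sigma>"
  have \<tau>: "?\<tau> permutes {..<q}"
    using assms by (rule permutes_inv)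
  show "twist \<sigma> permutes verts q"
    by (rule permutesI[of _ _ "twist ?\<tau>"])
      (simp_all add: twist_in_verts assms \<tau> twist_twist permutes_inv_o[OF assms] twist_id,
        simp add: twist_def)
qed (simp_all add: twist_ancestor omega_ray_eq_om)

lemma Phi_twist [simp]: "Phi (twist \<sigma>) = 0"
  by (simp add: Phi_def origin_eq_om)

lemma eq_origin_iff:
  "v \<in> verts q \<Longrightarrow> v = origin \<longleftrightarrow> fst v = 0 \<and> (\<forall>k\<le>0. snd v k = 0)"
  by (cases v) (auto simp: verts_iff origin_eq_om om_def fun_eq_iff not_le[symmetric] simp del: not_le)

text \<open>The entry with index 1 is the newly appended label only for children of vertices at
  height 0, and among these parents only the origin has its children twisted.\<close>

lemma portrait_twist:
  assumes \<sigma>: "\<sigma> permutes {..<q}" and v: "v \<in> verts q"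
  shows "portrait q (twist \<sigma>) v = (if v = origin then \<sigma> else id)"
proof (rule portrait_eqI[OF twist_in_Aff[OF \<sigma>] v])
  fix t assume t: "t < q"
  have c: "child v t \<in> verts q"
    using v t by simp
  consider "v = origin" | "v \<noteq> origin" "fst v = 0" | "fst v \<ge> 1" | "fst v < 0"
    by linarith
  then show "twist \<sigma> (child v t) = child (twist \<sigma> v) ((if v = origin then \<sigma> else id) t)"
  proof cases
    case 1
    with c show ?thesis
      by (auto simp: twist_def origin_eq_om) (auto simp: child_def om_def)
  next
    case 2
    then obtain k where k: "k \<le> 0" "snd v k \<noteq> 0"
      using eq_origin_iff[OF v] by auto
    then have "snd (child v t) k \<noteq> 0"
      using 2 by (simp add: child_def)
    with k 2 show ?thesis
      by (auto simp: twist_def)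
  next
    case 3
    then have "v \<noteq> origin"
      by (auto simp: origin_eq_om)
    with c v 3 show ?thesis
      by (auto simp: twist_def) (auto simp: child_def fun_eq_iff)
  next
    case 4
    then have "v \<noteq> origin"
      by (auto simp: origin_eq_om)
    with 4 show ?thesis
      by (simp add: twist_def)
  qed
qed (auto simp: \<sigma> permutes_id)

text \<open>For uniqueness: a horocyclic element fixes the ray to \<omega> far up, as
  \<open>twist \<sigma>\<close> does, and equal portraits then force equality everywhere.\<close>

lemma delta_o_eq_twist:
  assumes \<sigma>: "\<sigma> permutes {..<q}"
  shows "delta_o q \<sigma> = twist \<sigma>"
  unfolding delta_o_def
proof (rule the_equality)
  have H: "twist \<sigma> \<in> Hor q"
    by (simp add: Hor_def twist_in_Aff \<sigma>)
  show "twist \<sigma> \<in> Hor q \<and>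
    (\<forall>v\<in>verts q. hor_portrait q (twist \<sigma>) v = (if v = origin then \<sigma> else id))"
    using H by (simp add: hor_portrait_eq twist_in_Aff portrait_twist \<sigma>)
  fix \<gamma> assume "\<gamma> \<in> Hor q \<and>
    (\<forall>v\<in>verts q. hor_portrait q \<gamma> v = (if v = origin then \<sigma> else id))"
  then have \<gamma>: "\<gamma> \<in> Hor q" "\<gamma> \<in> carrier (Aff q)"
    "\<And>v. v \<in> verts q \<Longrightarrow> portrait q \<gamma> v = (if v = origin then \<sigma> else id)"
    by (auto simp: Hor_def hor_portrait_eq)
  obtain a where "a \<ge> 0" "\<forall>j\<ge>a. \<gamma> (om j) = om j"
    using Hor_fixes_om[OF \<gamma>(1)] by blast
  then have "\<gamma> (om a) = twist \<sigma> (om a)"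
    by simp
  then show "\<gamma> = twist \<sigma>"
    by (rule Aff_eqI[OF \<gamma>(2) twist_in_Aff[OF \<sigma>] om_in_verts]) (simp add: \<gamma>(3) portrait_twist \<sigma>)
qed


section \<open>The tree as a Cayley graph\<close>

text \<open>Each vertex is joined to its neighbours by edges of all \<open>q + 1\<close> colours: \<open>color v\<close> is the
  colour of the edge from \<open>v\<close> to its ancestor, and the edge to the child \<open>vt\<close> has colour
  \<open>color v + 1 + t\<close> modulo \<open>q + 1\<close>.\<close>

definition color :: "vertex \<Rightarrow> nat" where
  "color v = nat ((fst v + (\<Sum>k | snd v k \<noteq> 0. int (snd v k))) mod int (q + 1))"

definition neighbor :: "nat \<Rightarrow> vertex \<Rightarrow> vertex" where
  "neighbor i v = (if color v = i then ancestor v else child v ((i + q - color v) mod (q + 1)))"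

lemma color_less [simp]: "color v < Suc q"
  by (simp add: color_def nat_less_iff)

lemma finite_support: "v \<in> verts q \<Longrightarrow> finite {k. snd v k \<noteq> 0}"
proof -
  assume "v \<in> verts q"
  then obtain N where "\<forall>k<N. snd v k = 0" "\<forall>k>fst v. snd v k = 0"
    by (auto simp: verts_iff)
  then have "{k. snd v k \<noteq> 0} \<subseteq> {N..fst v}"
    by (auto simp: not_less[symmetric] simp del: not_less)
  then show ?thesis
    using finite_subset by blast
qed

text \<open>Appending \<open>t\<close> raises the height by 1 and the digit sum by \<open>t\<close>.
  The increments \<open>1 + t\<close> run through the nonzero residues modulo \<open>q + 1\<close>,
  so the edges at a vertex carry each colour once.\<close>

lemma color_child:
  assumes v: "v \<in> verts q"
  shows "color (child v t) = (color v + 1 + t) mod (q + 1)"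
proof -
  let ?s = "\<lambda>v :: vertex. \<Sum>k | snd v k \<noteq> 0. int (snd v k)"
  have 0: "snd v (fst v + 1) = 0"
    using v by (simp add: verts_iff)
  have s: "?s (child v t) = ?s v + int t"
  proof (cases "t = 0")
    case True
    with 0 have "snd (child v t) = snd v"
      by (auto simp: child_def fun_eq_iff)
    with True show ?thesis
      by simp
  next
    case False
    then have "{k. snd (child v t) k \<noteq> 0} = insert (fst v + 1) {k. snd v k \<noteq> 0}"
      by (auto simp: child_def)
    moreover have "(\<Sum>k | snd v k \<noteq> 0. int (snd (child v t) k)) = ?s v"
      using 0 by (intro sum.cong) (auto simp: child_def)
    moreover have "snd (child v t) (fst v + 1) = t"
      by (simp add: child_def)
    ultimately show ?thesis
      using 0 finite_support[OF v] by simp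
  qed
  have color: "int (color w) = (fst w + ?s w) mod int (q + 1)" for w
    by (simp add: color_def)
  have "fst (child v t) + ?s (child v t) = fst v + ?s v + (1 + int t)"
    unfolding s by simp
  then have "int (color (child v t)) = (int (color v) + (1 + int t)) mod int (q + 1)"
    unfolding color by (simp only: mod_add_left_eq)
  also have "\<dots> = int ((color v + 1 + t) mod (q + 1))"
    by (simp add: zmod_int algebra_simps)
  finally show ?thesis
    by (simp only: of_nat_eq_iff)
qed

lemma color_child':
  assumes "v \<in> verts q" "t < q"
  shows "color (child v t) = (if color v + t < q then color v + 1 + t else color v + t - q)"
proof (cases "color v + t < q")
  case False
  then have "(color v + 1 + t) mod (q + 1) = (color v + t - q) mod (q + 1)"
    using le_mod_geq[of "q + 1" "color v + 1 + t"] by simp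
  also have "color v + t - q < q + 1"
    using color_less[of v] assms(2) by linarith
  then have "(color v + t - q) mod (q + 1) = color v + t - q"
    by (rule mod_less)
  finally show ?thesis
    using False by (simp add: color_child[OF assms(1)])
qed (simp add: color_child[OF assms(1)])

lemma color_child_neq: "v \<in> verts q \<Longrightarrow> t < q \<Longrightarrow> color (child v t) \<noteq> color v"
  using color_child'[of v t] color_less[of v] by (auto split: if_splits)

lemma neighbor_color: "neighbor (color v) v = ancestor v"
  by (simp add: neighbor_def)

text \<open>Adding \<open>q\<close> subtracts 1 modulo \<open>q + 1\<close> without leaving the
  natural numbers, so \<open>i + q - color v\<close> recovers \<open>t\<close> from the colour
  \<open>i\<close> of the child.\<close>

lemma neighbor_color_child:
  assumes "v \<in> verts q" "t < q"
  shows "neighbor (color (child v t)) v = child v t"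
proof -
  have "(color (child v t) + q - color v) mod (q + 1) = t"
  proof (cases "color v + t < q")
    case True
    then have "color (child v t) + q - color v = t + (q + 1)"
      by (simp add: color_child'[OF assms])
    then show ?thesis
      using assms(2) by (simp only: mod_add_self2) simp
  next
    case False
    then have "color (child v t) + q - color v = t"
      by (simp add: color_child'[OF assms])
    then show ?thesis
      using assms(2) by simp
  qed
  then show ?thesis
    using color_child_neq[OF assms] by (simp add: neighbor_def)
qed

lemma color_cases:
  assumes "v \<in> verts q" "i < q + 1"
  obtains "i = color v" | t where "t < q" "i = color (child v t)"
proof (cases "i = color v")
  case False
  \<comment> \<open>The solution of \<open>color v + 1 + t = i\<close> modulo \<open>q + 1\<close>;
    the first branch is the one that wraps around.\<close>
  define t where "t = (if i < color v then i + q - color v else i - color v - 1)"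
  have le: "color v \<le> q"
    using color_less[of v] by linarith
  have t: "t < q"
    using False assms q_ge_2 by (auto simp: t_def)
  moreover have "color (child v t) = i"
    using False assms le unfolding color_child'[OF assms(1) t] by (auto simp: t_def)
  ultimately show ?thesis
    using that by blast
qed (use that in blast)

lemma neighbor_in_verts:
  assumes "v \<in> verts q" "i < q + 1"
  shows "neighbor i v \<in> verts q"
  using assms by (rule color_cases) (simp_all add: neighbor_color neighbor_color_child assms)

text \<open>An edge has one colour, that of its lower end, so crossing it again leads back. Each
  colour is thus an involution of the vertex set, as a generator of the free product
  requires.\<close>

lemma neighbor_neighbor:
  assumes v: "v \<in> verts q" and i: "i < q + 1"
  shows "neighbor i (neighbor i v) = v"
  using v i
proof (rule color_cases)
  assume "i = color v"
  then show ?thesis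
    using v neighbor_color_child[of "ancestor v" "label v"] by (simp add: neighbor_color)
next
  fix t assume "t < q" "i = color (child v t)"
  then show ?thesis
    using v by (simp add: neighbor_color_child neighbor_color)
qed

section \<open>The free product acting by coloured walks\<close>

definition walk :: "nat list \<Rightarrow> vertex \<Rightarrow> vertex" where
  "walk w v = fold neighbor w v"

lemma walk_simps [simp]:
  "walk [] v = v" "walk (s # w) v = walk w (neighbor s v)"
  "walk (w @ w') v = walk w' (walk w v)"
  by (simp_all add: walk_def)

lemma walk_in_verts: "v \<in> verts q \<Longrightarrow> set w \<subseteq> {..<q + 1} \<Longrightarrow> walk w v \<in> verts q"
  by (induction w arbitrary: v) (auto simp: neighbor_in_verts simp del: add_Suc_right)

lemma walk_rev:
  "v \<in> verts q \<Longrightarrow> set w \<subseteq> {..<q + 1} \<Longrightarrow> walk (rev w) (walk w v) = v"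
  by (induction w arbitrary: v) (simp_all add: neighbor_in_verts neighbor_neighbor)

text \<open>Reduction removes pairs of equal letters, which walk along an edge and back; so walking
  is a right action of the free product.\<close>

lemma walk_foldr_red_cons:
  assumes "v \<in> verts q" "set x \<subseteq> {..<q + 1}"
  shows "walk (foldr red_cons x y) v = walk y (walk x v)"
  using assms
proof (induction x arbitrary: v)
  case (Cons s x)
  have "walk (red_cons s w) v = walk w (neighbor s v)" for w
    using Cons.prems by (cases w) (simp_all add: neighbor_neighbor)
  with Cons show ?case
    by (simp add: neighbor_in_verts)
qed simp

text \<open>After a descent the only way up is the edge just crossed, whose colour the next letter
  must avoid. A reduced walk that starts downwards never turns.\<close>

lemma fst_walk_down:
  assumes "v \<in> verts q" "set w \<subseteq> {..<q + 1}" "distinct_adj w" "w \<noteq> [] \<Longrightarrow> hd w \<noteq> color v"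
  shows "fst (walk w v) = fst v + int (length w)"
  using assms
proof (induction w arbitrary: v)
  case (Cons s w)
  then obtain t where t: "t < q" "s = color (child v t)"
    by (metis color_cases insert_subset lessThan_iff list.sel(1) list.simps(15) list.distinct(1))
  then have "neighbor s v = child v t"
    using Cons.prems by (simp add: neighbor_color_child)
  then show ?case
    using Cons.IH[of "child v t"] Cons.prems t by (auto simp: distinct_adj_Cons)
qed simp

text \<open>Freeness of the action. A closed reduced walk cannot start downwards, and neither can
  its reverse, so its first and last letters are both \<open>color v\<close>. Removing them leaves a
  shorter closed reduced walk at \<open>ancestor v\<close>, nonempty because two equal letters
  cannot be adjacent.\<close>

lemma walk_neq:
  assumes "v \<in> verts q" "set w \<subseteq> {..<q + 1}" "distinct_adj w" "w \<noteq> []"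
  shows "walk w v \<noteq> v"
  using assms
proof (induction "length w" arbitrary: v w rule: less_induct)
  case less
  show ?case
  proof
    assume closed: "walk w v = v"
    have hd: "hd u = color v"
      if "walk u v = v" "set u \<subseteq> {..<q + 1}" "distinct_adj u" "u \<noteq> []" for u
      using fst_walk_down[OF less.prems(1) that(2,3)] that(1,4) by fastforce
    have "walk (rev w) v = v"
      using walk_rev[of v w] less.prems closed by simp
    then have last: "last w = color v"
      using hd[of "rev w"] less.prems by (simp add: hd_rev)
    obtain u where u: "w = color v # u"
      using hd[OF closed] less.prems by (cases w) auto
    show False
    proof (cases u rule: rev_cases)
      case Nil
      then have "ancestor v = v"
        using closed u by (simp add: neighbor_color)
      then have "fst (ancestor v) = fst v"
        by simp
      then show False
        by simp
    next
      case (snoc u' c)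
      then have c: "c = color v"
        using last u by simp
      have verts: "walk u' (ancestor v) \<in> verts q"
        using less.prems u snoc by (intro walk_in_verts) auto
      have "neighbor c (walk u' (ancestor v)) = v"
        using closed u snoc by (simp add: neighbor_color)
      then have "walk u' (ancestor v) = ancestor v"
        using neighbor_neighbor[OF verts, of c] c color_less[of v] by (simp add: neighbor_color)
      moreover have "u' \<noteq> []"
        using less.prems(3) u snoc c by auto
      moreover have "distinct_adj u'"
        using less.prems(3) u snoc by (metis distinct_adj_ConsD distinct_adj_appendD1)
      ultimately show False
        using less.hyps[of u' "ancestor v"] less.prems u snoc by simp
    qed
  qed
qed

definition FP :: "nat list monoid" where
  "FP = free_prod_Z2 (q + 1)"

lemma carrier_FP: "carrier FP = {w. set w \<subseteq> {..<q + 1} \<and> distinct_adj w}"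
  and mult_FP: "x \<otimes>\<^bsub>FP\<^esub> y = foldr red_cons x y"
  and one_FP: "\<one>\<^bsub>FP\<^esub> = []"
  by (simp_all add: FP_def free_prod_Z2_def)

sublocale FP: group FP
  unfolding FP_def by (rule group_free_prod_Z2)

lemma letter_in_FP: "i < q + 1 \<Longrightarrow> [i] \<in> carrier FP"
  by (simp add: carrier_FP)

definition eta :: "nat list \<Rightarrow> vertex" where
  "eta w = walk w origin"

lemma eta_mult: "x \<in> carrier FP \<Longrightarrow> eta (x \<otimes>\<^bsub>FP\<^esub> y) = walk y (eta x)"
  unfolding eta_def by (simp add: carrier_FP mult_FP walk_foldr_red_cons origin_eq_om)

lemma eta_mult_letter: "x \<in> carrier FP \<Longrightarrow> eta (x \<otimes>\<^bsub>FP\<^esub> [i]) = neighbor i (eta x)"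
  by (simp add: eta_mult)

lemma eta_in_verts [simp]: "x \<in> carrier FP \<Longrightarrow> eta x \<in> verts q"
  unfolding eta_def by (intro walk_in_verts) (auto simp: carrier_FP origin_eq_om)

lemma inj_on_eta: "inj_on eta (carrier FP)"
proof (rule inj_onI)
  fix x y assume x: "x \<in> carrier FP" and y: "y \<in> carrier FP" and eq: "eta x = eta y"
  let ?w = "x \<otimes>\<^bsub>FP\<^esub> inv\<^bsub>FP\<^esub> y"
  have "eta ?w = eta (y \<otimes>\<^bsub>FP\<^esub> inv\<^bsub>FP\<^esub> y)"
    using x y eq by (simp only: eta_mult)
  also have "\<dots> = origin"
    using y by (simp add: eta_def one_FP)
  finally have "walk ?w origin = origin"
    by (simp add: eta_def)
  moreover have "?w \<in> carrier FP"
    using x y by simp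
  ultimately have "?w = []"
    using walk_neq[of origin ?w] by (auto simp: carrier_FP origin_eq_om)
  then have "?w = \<one>\<^bsub>FP\<^esub>"
    by (simp add: one_FP)
  then show "x = y"
    using x y by (metis FP.inv_solve_right' FP.l_one FP.one_closed)
qed

lemma neighbor_in_range_eta:
  assumes "v \<in> eta ` carrier FP" "i < q + 1"
  shows "neighbor i v \<in> eta ` carrier FP"
proof -
  obtain x where "x \<in> carrier FP" "v = eta x"
    using assms(1) by blast
  then have "neighbor i v = eta (x \<otimes>\<^bsub>FP\<^esub> [i])" "x \<otimes>\<^bsub>FP\<^esub> [i] \<in> carrier FP"
    using letter_in_FP[OF assms(2)] by (simp_all add: eta_mult_letter)
  then show ?thesis
    by blast
qed

lemma eta_surj: "v \<in> verts q \<Longrightarrow> v \<in> eta ` carrier FP"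
proof -
  assume "v \<in> verts q"
  with om_in_verts[of 0] show ?thesis
  proof (induction rule: verts_connected)
    case base
    have "eta [] = om 0" "[] \<in> carrier FP"
      by (simp_all add: eta_def origin_eq_om carrier_FP)
    then show ?case
      by (metis imageI)
  next
    case (ancestor v)
    then show ?case
      using neighbor_in_range_eta[of v "color v"] color_less[of v] by (simp add: neighbor_color)
  next
    case (child v t)
    then show ?case
      using neighbor_in_range_eta[of v "color (child v t)"] color_less[of "child v t"]
      by (simp add: neighbor_color_child)
  qed
qed

definition theta :: "vertex \<Rightarrow> nat list" where
  "theta = inv_into (carrier FP) eta"

lemma theta_in_FP [simp]: "v \<in> verts q \<Longrightarrow> theta v \<in> carrier FP"
  unfolding theta_def by (intro inv_into_into eta_surj)

lemma eta_theta [simp]: "v \<in> verts q \<Longrightarrow> eta (theta v) = v"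
  unfolding theta_def by (intro f_inv_into_f eta_surj)

lemma theta_eta [simp]: "x \<in> carrier FP \<Longrightarrow> theta (eta x) = x"
  unfolding theta_def by (rule inv_into_f_f[OF inj_on_eta])

lemma theta_inject: "v \<in> verts q \<Longrightarrow> w \<in> verts q \<Longrightarrow> theta v = theta w \<longleftrightarrow> v = w"
  by (metis eta_theta)

text \<open>Along with bijectivity this identifies the coloured tree with the Cayley graph of
  \<open>FP\<close>.\<close>

lemma theta_neighbor:
  "v \<in> verts q \<Longrightarrow> i < q + 1 \<Longrightarrow> theta v \<otimes>\<^bsub>FP\<^esub> [i] = theta (neighbor i v)"
  by (metis FP.m_closed eta_mult_letter eta_theta letter_in_FP theta_eta theta_in_FP)


section \<open>The discrete affine group\<close>

lemma carrier_DA: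
  "carrier (DA q) = {g \<in> carrier (Aff q). finite {v \<in> verts q. portrait q g v \<noteq> id}}"
  by (simp add: DA_def)

lemma mult_DA [simp]: "g \<otimes>\<^bsub>DA q\<^esub> h = h \<circ> g"
  using mult_Aff by (simp add: DA_def)

lemma one_DA [simp]: "\<one>\<^bsub>DA q\<^esub> = id"
  using one_Aff by (simp add: DA_def)

lemma DA_in_Aff [simp]: "g \<in> carrier (DA q) \<Longrightarrow> g \<in> carrier (Aff q)"
  by (simp add: carrier_DA)

lemma finite_Aff_preimage:
  "g \<in> carrier (Aff q) \<Longrightarrow> finite {v \<in> verts q. P v} \<Longrightarrow> finite {v \<in> verts q. P (g v)}"
  by (rule finite_subset[OF _ finite_vimageI[of "{v \<in> verts q. P v}" g]])
    (auto dest: Aff_permutes permutes_inj)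

lemma group_DA: "group (DA q)"
proof -
  have "subgroup {g \<in> carrier (Aff q). finite {v \<in> verts q. portrait q g v \<noteq> id}} (Aff q)"
  proof (rule Aff.subgroupI)
    have "id \<in> carrier (Aff q)"
      using Aff.one_closed by simp
    moreover have "{v \<in> verts q. portrait q id v \<noteq> id} = {}"
      by (auto simp: portrait_id)
    ultimately have "id \<in> {g \<in> carrier (Aff q). finite {v \<in> verts q. portrait q g v \<noteq> id}}"
      by (simp only: mem_Collect_eq finite.emptyI)
    then show "{g \<in> carrier (Aff q). finite {v \<in> verts q. portrait q g v \<noteq> id}} \<noteq> {}"
      by blast
  next
    fix g assume "g \<in> {g \<in> carrier (Aff q). finite {v \<in> verts q. portrait q g v \<noteq> id}}"
    then have g: "g \<in> carrier (Aff q)" and fin: "finite {v \<in> verts q. portrait q g v \<noteq> id}"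
      by auto
    let ?h = "inv_into UNIV g"
    have h: "?h \<in> carrier (Aff q)"
      using g by (rule inv_in_Aff)
    \<comment> \<open>By the chain rule the portraits of the inverse at \<open>v\<close> and of
      \<open>g\<close> at \<open>?h v\<close> compose to the identity, so both are trivial or
      neither is.\<close>
    have "portrait q g (?h v) \<noteq> id" if "v \<in> verts q" "portrait q ?h v \<noteq> id" for v
      using that portrait_comp[OF h g, of v] portrait_id[of v]
      by (auto simp: permutes_inv_o(1)[OF Aff_permutes[OF g]])
    then have "{v \<in> verts q. portrait q ?h v \<noteq> id} \<subseteq> {v \<in> verts q. portrait q g (?h v) \<noteq> id}"
      by blast
    moreover have "finite {v \<in> verts q. portrait q g (?h v) \<noteq> id}"
      using finite_Aff_preimage[OF h fin] .
    ultimately show "inv\<^bsub>Aff q\<^esub> g \<in> {g \<in> carrier (Aff q). finite {v \<in> verts q. portrait q g v \<noteq> id}}"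
      using h finite_subset by (auto simp: inv_Aff[OF g])
  next
    fix g h assume "g \<in> {g \<in> carrier (Aff q). finite {v \<in> verts q. portrait q g v \<noteq> id}}"
      "h \<in> {g \<in> carrier (Aff q). finite {v \<in> verts q. portrait q g v \<noteq> id}}"
    then have g: "g \<in> carrier (Aff q)" and h: "h \<in> carrier (Aff q)"
      and fin: "finite {v \<in> verts q. portrait q g v \<noteq> id}" "finite {v \<in> verts q. portrait q h v \<noteq> id}"
      by auto
    have "{v \<in> verts q. portrait q (h \<circ> g) v \<noteq> id} \<subseteq>
        {v \<in> verts q. portrait q g v \<noteq> id} \<union> {v \<in> verts q. portrait q h (g v) \<noteq> id}"
      by (auto simp: portrait_comp g h)
    then have "finite {v \<in> verts q. portrait q (h \<circ> g) v \<noteq> id}"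
      using fin(1) finite_Aff_preimage[OF g fin(2)] finite_subset by blast
    then show "g \<otimes>\<^bsub>Aff q\<^esub> h \<in> {g \<in> carrier (Aff q). finite {v \<in> verts q. portrait q g v \<noteq> id}}"
      using g h by (simp add: comp_in_Aff)
  qed auto
  then show ?thesis
    unfolding DA_def by (rule subgroup.subgroup_is_group) (rule group_Aff)
qed

sublocale DA: group "DA q"
  by (rule group_DA)

lemma comp_in_DA: "g \<in> carrier (DA q) \<Longrightarrow> h \<in> carrier (DA q) \<Longrightarrow> h \<circ> g \<in> carrier (DA q)"
  using DA.m_closed[of g h] by simp

lemma shift_in_DA: "shift m \<in> carrier (DA q)"
proof -
  have "{v \<in> verts q. portrait q (shift m) v \<noteq> id} = {}"
    by auto
  then show ?thesis
    by (simp only: carrier_DA mem_Collect_eq shift_in_Aff finite.emptyI)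
qed

lemma twist_in_DA:
  assumes "\<sigma> permutes {..<q}"
  shows "twist \<sigma> \<in> carrier (DA q)"
proof -
  have "{v \<in> verts q. portrait q (twist \<sigma>) v \<noteq> id} \<subseteq> {origin}"
    using assms by (auto simp: portrait_twist)
  then have "finite {v \<in> verts q. portrait q (twist \<sigma>) v \<noteq> id}"
    using finite_subset by blast
  then show ?thesis
    using twist_in_Aff[OF assms] unfolding carrier_DA by blast
qed

section \<open>The generators acting on position and portrait\<close>

definition gen :: "(nat \<Rightarrow> nat) \<Rightarrow> int \<Rightarrow> (nat \<Rightarrow> nat) \<Rightarrow> vertex \<Rightarrow> vertex" where
  "gen \<sigma> \<epsilon> \<sigma>' = twist \<sigma>' \<circ> (shift \<epsilon> \<circ> twist \<sigma>)"

lemma gen_in_DA: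
  "\<sigma> permutes {..<q} \<Longrightarrow> \<sigma>' permutes {..<q} \<Longrightarrow> gen \<sigma> \<epsilon> \<sigma>' \<in> carrier (DA q)"
  by (simp add: gen_def comp_in_DA twist_in_DA shift_in_DA)

lemma alpha_pow_DA:
  assumes "\<epsilon> = 1 \<or> \<epsilon> = - 1"
  shows "alpha q [^]\<^bsub>DA q\<^esub> \<epsilon> = shift \<epsilon>"
proof -
  have "alpha q [^]\<^bsub>DA q\<^esub> (1 :: int) = shift 1"
    by (simp add: alpha_eq_shift shift_in_DA)
  moreover have "inv\<^bsub>DA q\<^esub> (shift 1) = shift (- 1)"
    by (intro DA.inv_equality) (auto simp: shift_add shift_in_DA)
  then have "alpha q [^]\<^bsub>DA q\<^esub> (- 1 :: int) = shift (- 1)"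
    by (simp add: alpha_eq_shift shift_in_DA DA.int_pow_neg)
  ultimately show ?thesis
    using assms by auto
qed

lemma S1_eq:
  "S1 q = {gen \<sigma> \<epsilon> \<sigma>' | \<sigma> \<sigma>' \<epsilon>.
    \<sigma> permutes {..<q} \<and> \<sigma>' permutes {..<q} \<and> (\<epsilon> = 1 \<or> \<epsilon> = - 1)}"
proof -
  have "delta_o q \<sigma> \<otimes>\<^bsub>DA q\<^esub> (alpha q [^]\<^bsub>DA q\<^esub> \<epsilon>) \<otimes>\<^bsub>DA q\<^esub> delta_o q \<sigma>' = gen \<sigma> \<epsilon> \<sigma>'"
    if "\<sigma> permutes {..<q}" "\<sigma>' permutes {..<q}" "\<epsilon> = 1 \<or> \<epsilon> = - 1" for \<sigma> \<sigma>' \<epsilon>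
    using that by (simp only: delta_o_eq_twist alpha_pow_DA mult_DA gen_def)
  then show ?thesis
    unfolding S1_def by (simp only: carrier_Sq mem_Collect_eq insert_iff empty_iff simp_thms) (smt (verit, best) Collect_cong)
qed

lemma S1_subset: "S1 q \<subseteq> carrier (DA q)"
  by (auto simp: S1_eq gen_in_DA)

definition pos :: "(vertex \<Rightarrow> vertex) \<Rightarrow> vertex" where
  "pos g = inv_into UNIV g origin"

lemma Aff_pos: "g \<in> carrier (Aff q) \<Longrightarrow> g (pos g) = origin"
  unfolding pos_def using permutes_inverses(1)[OF Aff_permutes] by blast

lemma pos_in_verts [simp]: "g \<in> carrier (Aff q) \<Longrightarrow> pos g \<in> verts q"
  using Aff_in_verts[of g "pos g"] Aff_pos[of g] by (simp add: origin_eq_om)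

lemma pos_eq_iff: "g \<in> carrier (Aff q) \<Longrightarrow> pos g = v \<longleftrightarrow> g v = origin"
  by (metis Aff_inject Aff_pos)

lemma gen_om: "j \<ge> 0 \<Longrightarrow> j - \<epsilon> \<ge> 0 \<Longrightarrow> gen \<sigma> \<epsilon> \<sigma>' (om j) = om (j - \<epsilon>)"
  by (simp add: gen_def)

text \<open>\<open>twist \<sigma>\<close> fixes the ancestor of the origin, so the upward move
  succeeds for every choice of \<open>\<sigma>\<close>.\<close>

lemma pos_gen_up:
  assumes "g \<in> carrier (Aff q)" "\<sigma> permutes {..<q}" "\<sigma>' permutes {..<q}"
  shows "pos (gen \<sigma> 1 \<sigma>' \<circ> g) = ancestor (pos g)"
proof -
  have "g (ancestor (pos g)) = om 1"
    using assms by (simp add: Aff_ancestor Aff_pos) (simp add: origin_eq_om)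
  then show ?thesis
    using assms by (simp add: pos_eq_iff comp_in_Aff gen_in_DA gen_om) (simp add: origin_eq_om)
qed

text \<open>The shift by -1 brings \<open>om (- 1)\<close>, the zero child of the origin, to the
  origin. So the position moves to the child whose label is sent to 0 by the portrait followed by
  \<open>\<sigma>\<close>.\<close>

lemma pos_gen_down:
  assumes g: "g \<in> carrier (Aff q)" and \<sigma>: "\<sigma> permutes {..<q}" "\<sigma>' permutes {..<q}"
    and t: "t < q" "\<sigma> (portrait q g (pos g) t) = 0"
  shows "pos (gen \<sigma> (- 1) \<sigma>' \<circ> g) = child (pos g) t"
proof -
  have "(twist \<sigma> \<circ> g) (child (pos g) t) = child ((twist \<sigma> \<circ> g) (pos g)) (portrait q (twist \<sigma> \<circ> g) (pos g) t)"
    by (rule Aff_child[OF comp_in_Aff[OF g twist_in_Aff[OF \<sigma>(1)]] pos_in_verts[OF g] t(1)])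
  also have "\<dots> = om (- 1)"
    using assms by (simp add: portrait_comp portrait_twist twist_in_Aff Aff_pos) (simp add: origin_eq_om)
  finally have "gen \<sigma> (- 1) \<sigma>' (g (child (pos g) t)) = om 0"
    by (simp add: gen_def)
  then show ?thesis
    using assms by (simp add: pos_eq_iff comp_in_Aff gen_in_DA) (simp add: origin_eq_om)
qed

lemma pos_gen_neighbor:
  assumes g: "g \<in> carrier (Aff q)" and \<sigma>: "\<sigma> permutes {..<q}" "\<sigma>' permutes {..<q}"
    and \<epsilon>: "\<epsilon> = 1 \<or> \<epsilon> = - 1"
  shows "\<exists>i<q + 1. pos (gen \<sigma> \<epsilon> \<sigma>' \<circ> g) = neighbor i (pos g)"
proof (cases "\<epsilon> = 1")
  case True
  then show ?thesis
    using pos_gen_up[OF g \<sigma>] by (intro exI[of _ "color (pos g)"]) (simp add: neighbor_color)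
next
  case False
  have perm: "\<sigma> \<circ> portrait q g (pos g) permutes {..<q}"
    using g \<sigma> by (intro permutes_compose portrait_permutes) auto
  define t where "t = inv_into UNIV (\<sigma> \<circ> portrait q g (pos g)) 0"
  have "(\<sigma> \<circ> portrait q g (pos g)) t = 0"
    unfolding t_def by (rule permutes_inverses(1)[OF perm])
  moreover from this have "t < q"
    using permutes_in_image[OF perm, of t] q_ge_2 by simp
  ultimately have "pos (gen \<sigma> \<epsilon> \<sigma>' \<circ> g) = child (pos g) t"
    using pos_gen_down[OF g \<sigma>, of t] False \<epsilon> by auto
  then show ?thesis
    using neighbor_color_child[OF pos_in_verts[OF g] \<open>t < q\<close>]
    by (intro exI[of _ "color (child (pos g) t)"]) simp
qed

text \<open>A twist shows up exactly at the vertex lying at the origin when it is applied: the old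
  position for \<open>\<sigma>\<close> and, since \<open>twist \<sigma>'\<close> fixes the origin,
  the new one for \<open>\<sigma>'\<close>. The shift keeps the two apart.\<close>

lemma portrait_gen:
  assumes g: "g \<in> carrier (Aff q)" and \<sigma>: "\<sigma> permutes {..<q}" "\<sigma>' permutes {..<q}"
    and \<epsilon>: "\<epsilon> = 1 \<or> \<epsilon> = - 1" and v: "v \<in> verts q"
  shows "portrait q (gen \<sigma> \<epsilon> \<sigma>' \<circ> g) v =
    (if v = pos g then \<sigma> \<circ> portrait q g v
     else if v = pos (gen \<sigma> \<epsilon> \<sigma>' \<circ> g) then \<sigma>' \<circ> portrait q g v
     else portrait q g v)"
proof -
  let ?g1 = "twist \<sigma> \<circ> g"
  let ?g2 = "shift \<epsilon> \<circ> ?g1"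
  have g1: "?g1 \<in> carrier (Aff q)"
    using g \<sigma> by (simp add: comp_in_Aff twist_in_Aff)
  then have g2: "?g2 \<in> carrier (Aff q)"
    using comp_in_Aff[OF g1, of "shift \<epsilon>"] by simp
  have eq: "gen \<sigma> \<epsilon> \<sigma>' \<circ> g = twist \<sigma>' \<circ> ?g2"
    by (simp add: gen_def comp_assoc)
  have g3: "twist \<sigma>' \<circ> ?g2 \<in> carrier (Aff q)"
    using comp_in_Aff[OF g2 twist_in_Aff[OF \<sigma>(2)]] .
  have origin: "g v = origin \<longleftrightarrow> v = pos g"
    using pos_eq_iff[OF g, of v] by auto
  have twist_origin: "twist \<sigma>' w = origin \<longleftrightarrow> w = origin" for w
    using Aff_inject[OF twist_in_Aff[OF \<sigma>(2)], of w origin] by (simp add: origin_eq_om)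
  have "?g2 v = origin \<longleftrightarrow> v = pos (twist \<sigma>' \<circ> ?g2)"
    using pos_eq_iff[OF g3, of v] twist_origin[of "?g2 v"] by auto
  moreover have "portrait q (shift \<epsilon>) (twist \<sigma> (g v)) = id"
    using Aff_in_verts[OF g1, of v] v by simp
  then have "portrait q (twist \<sigma>' \<circ> ?g2) v = portrait q (twist \<sigma>') (?g2 v) \<circ>
      (portrait q (twist \<sigma>) (g v) \<circ> portrait q g v)"
    using portrait_comp[OF g2 twist_in_Aff[OF \<sigma>(2)] v] portrait_comp[OF g1 shift_in_Aff v]
      portrait_comp[OF g twist_in_Aff[OF \<sigma>(1)] v] by simp
  moreover have "pos g \<noteq> pos (twist \<sigma>' \<circ> ?g2)"
  proof
    assume "pos g = pos (twist \<sigma>' \<circ> ?g2)"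
    then have "(twist \<sigma>' \<circ> ?g2) (pos g) = origin"
      using Aff_pos[OF g3] by simp
    then have "shift \<epsilon> (twist \<sigma> origin) = origin"
      using twist_origin[of "?g2 (pos g)"] by (simp add: Aff_pos[OF g])
    then show False
      using \<epsilon> by (auto simp: origin_eq_om)
  qed
  ultimately show ?thesis
    using Aff_in_verts[OF g2, of v] g \<sigma> v origin unfolding eq by (auto simp: portrait_twist)
qed


section \<open>The embedding\<close>

lemma Gamma_eq: "Gamma q = wreath (Sq q) FP"
  by (simp add: Gamma_def FP_def)

lemma group_Gamma: "group (Gamma q)"
  unfolding Gamma_eq by (intro group_wreath group_Sq FP.is_group)

sublocale Gamma: group "Gamma q"
  by (rule group_Gamma)

lemma carrier_Gamma:
  "(\<phi>, z) \<in> carrier (Gamma q) \<longleftrightarrow> \<phi> \<in> carrier FP \<rightarrow>\<^sub>E {\<sigma>. \<sigma> permutes {..<q}} \<and>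
    finite {u \<in> carrier FP. \<phi> u \<noteq> id} \<and> z \<in> carrier FP"
  by (simp add: Gamma_eq carrier_wreath[OF group_Sq])

definition gam :: "(nat \<Rightarrow> nat) \<Rightarrow> nat \<Rightarrow> (nat \<Rightarrow> nat) \<Rightarrow> (nat list \<Rightarrow> nat \<Rightarrow> nat) \<times> nat list" where
  "gam \<sigma> i \<sigma>' = (delta_e (Sq q) FP \<sigma>, \<one>\<^bsub>FP\<^esub>) \<otimes>\<^bsub>Gamma q\<^esub>
    (\<one>\<^bsub>sum_group (carrier FP) (\<lambda>_. Sq q)\<^esub>, [i]) \<otimes>\<^bsub>Gamma q\<^esub> (delta_e (Sq q) FP \<sigma>', \<one>\<^bsub>FP\<^esub>)"

lemma S_Gamma_eq:
  "S_Gamma q = {gam \<sigma> i \<sigma>' | \<sigma> \<sigma>' i. \<sigma> permutes {..<q} \<and> \<sigma>' permutes {..<q} \<and> i < q + 1}"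
  unfolding S_Gamma_def sws_gens_def free_prod_Z2_gens_def gam_def Gamma_eq FP_def[symmetric]
  by (auto simp del: one_sum_group)

lemma S_Gamma_subset: "S_Gamma q \<subseteq> carrier (Gamma q)"
  unfolding S_Gamma_def Gamma_eq FP_def[symmetric]
  by (intro sws_gens_subset group_Sq FP.is_group)
    (auto simp: free_prod_Z2_gens_def intro: letter_in_FP)

lemma mult_gam:
  assumes "(\<phi>, theta p) \<in> carrier (Gamma q)" "p \<in> verts q"
    and "\<sigma> permutes {..<q}" "\<sigma>' permutes {..<q}" "i < q + 1" "neighbor i p \<noteq> p"
  shows "(\<phi>, theta p) \<otimes>\<^bsub>Gamma q\<^esub> gam \<sigma> i \<sigma>' =
    (\<phi>(theta p := \<sigma> \<circ> \<phi> (theta p), theta (neighbor i p) := \<sigma>' \<circ> \<phi> (theta (neighbor i p))),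
     theta (neighbor i p))"
proof -
  have "theta (neighbor i p) \<noteq> theta p"
    using assms neighbor_in_verts[of p i] by (simp add: theta_inject)
  then show ?thesis
    using assms unfolding gam_def Gamma_eq
    by (subst wreath_mult_sws_gen[OF group_Sq FP.is_group])
      (simp_all add: letter_in_FP theta_neighbor Let_def del: one_sum_group)
qed

definition emb :: "(vertex \<Rightarrow> vertex) \<Rightarrow> (nat list \<Rightarrow> nat \<Rightarrow> nat) \<times> nat list" where
  "emb g = ((\<lambda>z\<in>carrier FP. portrait q g (eta z)), theta (pos g))"

lemma emb_in_Gamma: "g \<in> carrier (DA q) \<Longrightarrow> emb g \<in> carrier (Gamma q)"
proof -
  assume g: "g \<in> carrier (DA q)"
  then have "finite {v \<in> verts q. portrait q g v \<noteq> id}"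
    unfolding carrier_DA by blast
  from finite_vimage_IntI[OF this inj_on_eta]
  have "finite {z \<in> carrier FP. portrait q g (eta z) \<noteq> id}"
    by (rule finite_subset[rotated]) auto
  then have "finite {z \<in> carrier FP. (\<lambda>z\<in>carrier FP. portrait q g (eta z)) z \<noteq> id}"
    by (rule finite_subset[rotated]) auto
  moreover have "(\<lambda>z\<in>carrier FP. portrait q g (eta z)) \<in> carrier FP \<rightarrow>\<^sub>E {\<sigma>. \<sigma> permutes {..<q}}"
    using g by (auto simp: portrait_permutes)
  ultimately show ?thesis
    using g unfolding emb_def carrier_Gamma by simp
qed

lemma neighbor_neq: "v \<in> verts q \<Longrightarrow> i < q + 1 \<Longrightarrow> neighbor i v \<noteq> v"
  using walk_neq[of v "[i]"] by simp

text \<open>The switches are taken over unchanged and the letter is the colour of the edge crossed.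
  It depends on \<open>g\<close>, so a generator \<open>s\<close> has no fixed translation.\<close>

lemma emb_step:
  assumes g: "g \<in> carrier (DA q)" and s: "s \<in> S1 q"
  shows "\<exists>t\<in>S_Gamma q. emb g \<otimes>\<^bsub>Gamma q\<^esub> t = emb (g \<otimes>\<^bsub>DA q\<^esub> s)"
proof -
  obtain \<sigma> \<sigma>' \<epsilon> where s: "s = gen \<sigma> \<epsilon> \<sigma>'"
    and \<sigma>: "\<sigma> permutes {..<q}" "\<sigma>' permutes {..<q}" "\<epsilon> = 1 \<or> \<epsilon> = - 1"
    using s by (auto simp: S1_eq)
  have g': "g \<in> carrier (Aff q)"
    using g by simp
  obtain i where i: "i < q + 1" "pos (gen \<sigma> \<epsilon> \<sigma>' \<circ> g) = neighbor i (pos g)"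
    using pos_gen_neighbor[OF g' \<sigma>] by blast
  have p: "pos g \<in> verts q" "neighbor i (pos g) \<in> verts q" "neighbor i (pos g) \<noteq> pos g"
    using g' i neighbor_in_verts neighbor_neq by auto
  have eta_eq: "z = theta v \<longleftrightarrow> eta z = v" if "z \<in> carrier FP" "v \<in> verts q" for z v
    using that by auto
  have "emb g \<otimes>\<^bsub>Gamma q\<^esub> gam \<sigma> i \<sigma>' = emb (gen \<sigma> \<epsilon> \<sigma>' \<circ> g)"
    using mult_gam[OF emb_in_Gamma[OF g, unfolded emb_def] p(1) \<sigma>(1,2) i(1) p(3)] p
    by (auto simp: emb_def i(2) fun_eq_iff portrait_gen[OF g' \<sigma>] eta_eq)
  then show ?thesis
    using \<sigma> i(1) unfolding s S_Gamma_eq mult_DA by blast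
qed

text \<open>A walk in \<open>\<Gamma>\<close> is followed in \<open>DA(T)\<close> by an element \<open>g\<close> at the same position whose portrait may
  deviate from the lamps only at a proper ancestor of the position (where \<open>g v = om j\<close>, \<open>j \<ge> 1\<close>),
  and only if the lamp would lead off the path from \<open>v\<close> to the position.\<close>

definition follows :: "(nat list \<Rightarrow> nat \<Rightarrow> nat) \<times> nat list \<Rightarrow> (vertex \<Rightarrow> vertex) \<Rightarrow> bool" where
  "follows c g \<longleftrightarrow> c \<in> carrier (Gamma q) \<and> g \<in> carrier (DA q) \<and> snd c = theta (pos g) \<and>
    (\<forall>v\<in>verts q. portrait q g v = fst c (theta v) \<or>
      (\<exists>j\<ge>1. g v = om j \<and> fst c (theta v) (inv_into UNIV (portrait q g v) 0) \<noteq> 0))"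

lemma follows_emb: "g \<in> carrier (DA q) \<Longrightarrow> follows (emb g) g"
  using emb_in_Gamma[of g] by (auto simp: follows_def emb_def)

text \<open>The vertices sent to the ray from the origin to \<omega> are the position and its
  ancestors; they depend on \<open>pos g\<close> alone.\<close>

lemma om_eq_funpow_pos:
  assumes "g \<in> carrier (Aff q)" "w \<in> verts q"
  shows "g w = om (int n) \<longleftrightarrow> w = (ancestor ^^ n) (pos g)"
proof -
  have "g ((ancestor ^^ n) (pos g)) = om (int n)"
  proof (induction n)
    case 0
    then show ?case
      using assms by (simp add: Aff_pos origin_eq_om)
  next
    case (Suc n)
    then show ?case
      using assms by (simp add: Aff_ancestor funpow_ancestor_in_verts add.commute)
  qed
  then show ?thesis
    using Aff_inject[OF assms(1)] by metis
qed

text \<open>Equal positions make \<open>g\<close> and \<open>h\<close> agree about which vertex goes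
  to \<open>om j\<close> for each \<open>j \<ge> 0\<close>. At a deviation the lamp of
  \<open>h\<close> would lead off the path to the position, yet this lamp is the portrait of
  \<open>h\<close>, which must map that path to the ray.\<close>

lemma follows_emb_imp_eq:
  assumes "follows (emb h) g" "h \<in> carrier (DA q)"
  shows "g = h"
proof -
  have g: "g \<in> carrier (Aff q)" and h: "h \<in> carrier (Aff q)"
    using assms by (auto simp: follows_def)
  have "theta (pos g) = theta (pos h)"
    using assms by (simp add: follows_def emb_def)
  then have pos: "pos g = pos h"
    using g h by (simp add: theta_inject)
  have same: "g w = om j \<longleftrightarrow> h w = om j" if "w \<in> verts q" "j \<ge> 0" for w j
    using om_eq_funpow_pos[OF g that(1), of "nat j"] om_eq_funpow_pos[OF h that(1), of "nat j"]
      pos that(2) by simp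
  have "portrait q g v = portrait q h v" if v: "v \<in> verts q" for v
  proof (rule ccontr)
    \<comment> \<open>Once \<open>g v = om j\<close> with \<open>j \<ge> 1\<close>, this labels the
      next vertex on the path from \<open>v\<close> down to the position.\<close>
    let ?t = "inv_into UNIV (portrait q g v) 0"
    assume "portrait q g v \<noteq> portrait q h v"
    then obtain j where j: "j \<ge> 1" "g v = om j" "portrait q h v ?t \<noteq> 0"
      using assms v by (auto simp: follows_def emb_def)
    have perm: "portrait q g v permutes {..<q}"
      using g v by (rule portrait_permutes)
    have t0: "portrait q g v ?t = 0"
      by (rule permutes_inverses(1)[OF perm])
    then have t: "?t < q"
      using permutes_in_image[OF perm, of ?t] q_ge_2 by simp
    have "g (child v ?t) = om (j - 1)"
      using Aff_child[OF g v t] t0 j by simp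
    then have "h (child v ?t) = child (om j) 0"
      using same[of "child v ?t" "j - 1"] v t j by simp
    moreover have "h (child v ?t) = child (om j) (portrait q h v ?t)"
      using Aff_child[OF h v t] same[OF v, of j] j by simp
    ultimately show False
      using j(3) by (simp add: child_inject del: child_om)
  qed
  moreover have "g (pos g) = h (pos g)"
    using Aff_pos[OF g] Aff_pos[OF h] pos by simp
  ultimately show ?thesis
    using Aff_eqI[OF g h pos_in_verts[OF g]] by blast
qed

text \<open>Only a descent can create a deviation, at the vertex left, and only an ascent removes
  one, at the vertex reached. At other ancestors a deviation persists with \<open>j\<close> replaced
  by \<open>j - \<epsilon>\<close>.\<close>

lemma follows_step:
  assumes c: "follows c g" and t: "t \<in> S_Gamma q"
  shows "\<exists>s\<in>S1 q. follows (c \<otimes>\<^bsub>Gamma q\<^esub> t) (g \<otimes>\<^bsub>DA q\<^esub> s)"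
proof -
  obtain h1 h2 i where t: "t = gam h1 i h2"
    and h: "h1 permutes {..<q}" "h2 permutes {..<q}" and i: "i < q + 1"
    using t by (auto simp: S_Gamma_eq)
  have tc: "t \<in> carrier (Gamma q)"
    using S_Gamma_subset assms(2) by blast
  have gDA: "g \<in> carrier (DA q)" and g: "g \<in> carrier (Aff q)" and c_carr: "c \<in> carrier (Gamma q)"
    using c by (auto simp: follows_def)
  define p p' where "p = pos g" and "p' = neighbor i p"
  have p: "p \<in> verts q" "p' \<in> verts q" "p' \<noteq> p"
    using g i by (auto simp: p_def p'_def neighbor_in_verts neighbor_neq)
  obtain \<phi> where c_eq: "c = (\<phi>, theta p)"
    using c by (metis follows_def p_def prod.collapse)
  define L where "L v = \<phi> (theta v)" for v
  have L_perm: "L v permutes {..<q}" if "v \<in> verts q" for v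
    using c_carr that PiE_mem[of \<phi> "carrier FP" "\<lambda>_. {\<sigma>. \<sigma> permutes {..<q}}" "theta v"]
    by (simp add: c_eq carrier_Gamma L_def)
  have lamps: "portrait q g v = L v \<or>
      (\<exists>j\<ge>1. g v = om j \<and> L v (inv_into UNIV (portrait q g v) 0) \<noteq> 0)" if "v \<in> verts q" for v
    using c that by (simp add: follows_def c_eq L_def)
  have gp: "g p = om 0"
    using g by (simp add: p_def Aff_pos) (simp add: origin_eq_om)
  \<comment> \<open>A deviation requires \<open>j \<ge> 1\<close>, so at the position itself the
    portrait equals the lamp.\<close>
  have Lp: "portrait q g p = L p"
    using lamps[OF p(1)] gp by auto
  obtain \<psi> where ct: "c \<otimes>\<^bsub>Gamma q\<^esub> t = (\<psi>, theta p')"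
    and \<psi>: "\<And>v. v \<in> verts q \<Longrightarrow>
      \<psi> (theta v) = (if v = p then h1 \<circ> L v else if v = p' then h2 \<circ> L v else L v)"
    using mult_gam[OF c_carr[unfolded c_eq] p(1) h i p(3)[unfolded p'_def]] p
    unfolding c_eq t p'_def[symmetric] by (simp add: theta_inject L_def)
  have ct_carr: "c \<otimes>\<^bsub>Gamma q\<^esub> t \<in> carrier (Gamma q)"
    using c_carr tc by simp
  \<comment> \<open>The part common to both directions. In an ascent, \<open>anc\<close> says that
    the only vertex about to reach the origin is \<open>p'\<close>, where \<open>at_p'\<close> makes
    the portrait exact.\<close>
  have followsI: "\<exists>s\<in>S1 q. follows (c \<otimes>\<^bsub>Gamma q\<^esub> t) (g \<otimes>\<^bsub>DA q\<^esub> s)"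
    if \<sigma>: "\<sigma> permutes {..<q}" "\<sigma>' permutes {..<q}" "\<epsilon> = 1 \<or> \<epsilon> = - 1"
      and pos: "pos (gen \<sigma> \<epsilon> \<sigma>' \<circ> g) = p'"
      and at_p: "\<sigma> = h1 \<or> (\<epsilon> = - 1 \<and> h1 (L p (inv_into UNIV (\<sigma> \<circ> portrait q g p) 0)) \<noteq> 0)"
      and at_p': "\<sigma>' \<circ> portrait q g p' = h2 \<circ> L p'"
      and anc: "\<And>v. \<epsilon> = 1 \<Longrightarrow> v \<in> verts q \<Longrightarrow> g v = om 1 \<Longrightarrow> v = p'"
    for \<sigma> \<sigma>' \<epsilon>
  proof
    let ?s = "gen \<sigma> \<epsilon> \<sigma>'"
    show "?s \<in> S1 q"
      using \<sigma> by (auto simp: S1_eq)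
    have "portrait q (?s \<circ> g) v = \<psi> (theta v) \<or>
      (\<exists>j\<ge>1. (?s \<circ> g) v = om j \<and> \<psi> (theta v) (inv_into UNIV (portrait q (?s \<circ> g) v) 0) \<noteq> 0)"
      if v: "v \<in> verts q" for v
    proof -
      note portrait = portrait_gen[OF g \<sigma> v, folded p_def, unfolded pos]
      consider "v = p" | "v = p'" | "v \<noteq> p" "v \<noteq> p'"
        by blast
      then show ?thesis
      proof cases
        case 1
        \<comment> \<open>If \<open>h1\<close> was replaced, the step is a descent and sends
          \<open>p\<close> to \<open>om 1\<close>, so the deviation clause holds with
          \<open>j = 1\<close>.\<close>
        then show ?thesis
          using at_p portrait \<psi>[OF p(1)] Lp gp by (auto simp: gen_om)
      next
        case 2
        then show ?thesis
          using at_p' portrait \<psi>[OF p(2)] p by simp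
      next
        case 3
        then have eq: "portrait q (?s \<circ> g) v = portrait q g v" "\<psi> (theta v) = L v"
          using portrait \<psi>[OF v] by simp_all
        show ?thesis
        proof (rule disjE[OF lamps[OF v]])
          assume "\<exists>j\<ge>1. g v = om j \<and> L v (inv_into UNIV (portrait q g v) 0) \<noteq> 0"
          then obtain j where j: "j \<ge> 1" "g v = om j" "L v (inv_into UNIV (portrait q g v) 0) \<noteq> 0"
            by blast
          then have "j - \<epsilon> \<ge> 1"
            using \<sigma>(3) anc[OF _ v] 3 by (cases "j = 1") auto
          then show ?thesis
            using j eq by (intro disjI2 exI[of _ "j - \<epsilon>"]) (simp add: gen_om)
        qed (simp add: eq)
      qed
    qed
    then show "follows (c \<otimes>\<^bsub>Gamma q\<^esub> t) (g \<otimes>\<^bsub>DA q\<^esub> ?s)"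
      using ct_carr gDA \<sigma> by (simp add: follows_def ct pos comp_in_DA gen_in_DA)
  qed
  show ?thesis
    using p(1) i
  proof (rule color_cases)
    assume "i = color p"
    then have p': "p' = ancestor p"
      by (simp add: p'_def neighbor_color)
    \<comment> \<open>The portrait at \<open>p'\<close> may deviate from the lamp; this switch
      undoes it and installs the prescribed value.\<close>
    define \<sigma>' where "\<sigma>' = h2 \<circ> L p' \<circ> inv_into UNIV (portrait q g p')"
    have perm: "portrait q g p' permutes {..<q}"
      using g p by (intro portrait_permutes)
    have \<sigma>': "\<sigma>' permutes {..<q}"
      unfolding \<sigma>'_def using h p perm by (intro permutes_compose permutes_inv L_perm)
    have "pos (gen h1 1 \<sigma>' \<circ> g) = p'"
      using pos_gen_up[OF g h(1) \<sigma>'] by (simp add: p' p_def)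
    moreover have "\<sigma>' \<circ> portrait q g p' = h2 \<circ> L p'"
      by (simp add: \<sigma>'_def comp_assoc permutes_inv_o(2)[OF perm])
    moreover have "v = p'" if "v \<in> verts q" "g v = om 1" for v
      using om_eq_funpow_pos[OF g that(1), of 1] that(2) by (simp add: p' p_def)
    ultimately show ?thesis
      using h(1) \<sigma>' by (intro followsI[of h1 \<sigma>' 1]) auto
  next
    fix u assume u: "u < q" "i = color (child p u)"
    then have p': "p' = child p u"
      using p by (simp add: p'_def neighbor_color_child)
    \<comment> \<open>The image of \<open>p'\<close> lies below the origin and every
      \<open>om j\<close> with \<open>j \<ge> 1\<close> above it, so \<open>p'\<close> carries no
      deviation.\<close>
    have "fst (g p') = 1"
      using fst_Aff[OF g p(2)] fst_Aff[OF g p(1)] gp by (simp add: p')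
    then have "g p' \<noteq> om j" if "j \<ge> 1" for j
      using that by auto
    then have Lp': "portrait q g p' = L p'"
      using lamps[OF p(2)] by blast
    define a where "a = L p u"
    have a: "a < q"
      using permutes_in_image[OF L_perm[OF p(1)], of u] u by (simp add: a_def)
    \<comment> \<open>Any permutation taking \<open>a\<close> to 0 makes the position descend to
      \<open>child p u\<close>. If \<open>h1\<close> does not do so, \<open>h1 a \<noteq> 0\<close>
      is just what the deviation clause records.\<close>
    define \<sigma> where "\<sigma> = (if h1 a = 0 then h1 else transpose 0 a)"
    have \<sigma>: "\<sigma> permutes {..<q}"
      using h(1) a q_ge_2 by (simp add: \<sigma>_def permutes_swap_id)
    have \<sigma>0: "\<sigma> a = 0"
      by (simp add: \<sigma>_def)
    have "pos (gen \<sigma> (- 1) h2 \<circ> g) = p'"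
      using pos_gen_down[OF g \<sigma> h(2) u(1)] Lp \<sigma>0 by (simp add: p' p_def a_def)
    moreover have "inv_into UNIV (\<sigma> \<circ> portrait q g p) 0 = u"
    proof -
      have "\<sigma> \<circ> portrait q g p permutes {..<q}"
        using \<sigma> g p by (intro permutes_compose portrait_permutes)
      then show ?thesis
        using \<sigma>0 by (intro inv_f_eq permutes_inj) (auto simp: Lp a_def)
    qed
    then have "\<sigma> = h1 \<or> h1 (L p (inv_into UNIV (\<sigma> \<circ> portrait q g p) 0)) \<noteq> 0"
      by (simp add: \<sigma>_def a_def)
    ultimately show ?thesis
      using h(2) \<sigma> Lp' by (intro followsI[of \<sigma> h2 "- 1"]) auto
  qed
qed

section \<open>Translation of words in both directions\<close>

lemma emb_word:
  assumes "g \<in> carrier (DA q)" "set w \<subseteq> S1 q"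
  shows "\<exists>w'. set w' \<subseteq> S_Gamma q \<and> length w' = length w \<and>
    foldl (\<otimes>\<^bsub>Gamma q\<^esub>) (emb g) w' = emb (foldl (\<otimes>\<^bsub>DA q\<^esub>) g w)"
  using assms
proof (induction w arbitrary: g)
  case (Cons s w)
  then obtain t where t: "t \<in> S_Gamma q" "emb g \<otimes>\<^bsub>Gamma q\<^esub> t = emb (g \<otimes>\<^bsub>DA q\<^esub> s)"
    using emb_step[of g s] by auto
  have "g \<otimes>\<^bsub>DA q\<^esub> s \<in> carrier (DA q)"
    using Cons.prems S1_subset by (intro DA.m_closed) auto
  then obtain w' where "set w' \<subseteq> S_Gamma q" "length w' = length w"
      "foldl (\<otimes>\<^bsub>Gamma q\<^esub>) (emb (g \<otimes>\<^bsub>DA q\<^esub> s)) w' = emb (foldl (\<otimes>\<^bsub>DA q\<^esub>) (g \<otimes>\<^bsub>DA q\<^esub> s) w)"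
    using Cons.IH[of "g \<otimes>\<^bsub>DA q\<^esub> s"] Cons.prems by (auto simp del: mult_DA)
  with t show ?case
    by (intro exI[of _ "t # w'"]) (simp del: mult_DA)
qed simp

lemma follows_word:
  assumes "follows c g" "set w \<subseteq> S_Gamma q"
  shows "\<exists>w'. set w' \<subseteq> S1 q \<and> length w' = length w \<and>
    follows (foldl (\<otimes>\<^bsub>Gamma q\<^esub>) c w) (foldl (\<otimes>\<^bsub>DA q\<^esub>) g w')"
  using assms
proof (induction w arbitrary: c g)
  case (Cons t w)
  then obtain s where s: "s \<in> S1 q" "follows (c \<otimes>\<^bsub>Gamma q\<^esub> t) (g \<otimes>\<^bsub>DA q\<^esub> s)"
    using follows_step[of c g t] by auto
  then obtain w' where "set w' \<subseteq> S1 q" "length w' = length w"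
      "follows (foldl (\<otimes>\<^bsub>Gamma q\<^esub>) (c \<otimes>\<^bsub>Gamma q\<^esub> t) w) (foldl (\<otimes>\<^bsub>DA q\<^esub>) (g \<otimes>\<^bsub>DA q\<^esub> s) w')"
    using Cons.IH[OF s(2)] Cons.prems by (auto simp del: mult_DA)
  with s show ?case
    by (intro exI[of _ "s # w'"]) (simp del: mult_DA)
qed simp

text \<open>The lengths of all connecting words coincide on the two sides, hence so do the least
  ones.\<close>

lemma word_dist_emb:
  assumes g: "g \<in> carrier (DA q)" and h: "h \<in> carrier (DA q)"
  shows "word_dist (Gamma q) (S_Gamma q) (emb g) (emb h) = word_dist (DA q) (S1 q) g h"
proof -
  have "(\<exists>w. set w \<subseteq> S_Gamma q \<and> length w = n \<and> foldl (\<otimes>\<^bsub>Gamma q\<^esub>) (emb g) w = emb h) \<longleftrightarrow>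
    (\<exists>w. set w \<subseteq> S1 q \<and> length w = n \<and> foldl (\<otimes>\<^bsub>DA q\<^esub>) g w = h)" for n
  proof
    assume "\<exists>w. set w \<subseteq> S_Gamma q \<and> length w = n \<and> foldl (\<otimes>\<^bsub>Gamma q\<^esub>) (emb g) w = emb h"
    then obtain w where w: "set w \<subseteq> S_Gamma q" "length w = n"
      "foldl (\<otimes>\<^bsub>Gamma q\<^esub>) (emb g) w = emb h"
      by blast
    obtain w' where w': "set w' \<subseteq> S1 q" "length w' = n"
      "follows (emb h) (foldl (\<otimes>\<^bsub>DA q\<^esub>) g w')"
      using follows_word[OF follows_emb[OF g] w(1)] w(2,3) by auto
    then show "\<exists>w. set w \<subseteq> S1 q \<and> length w = n \<and> foldl (\<otimes>\<^bsub>DA q\<^esub>) g w = h"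
      using follows_emb_imp_eq[OF w'(3) h] by blast
  next
    assume "\<exists>w. set w \<subseteq> S1 q \<and> length w = n \<and> foldl (\<otimes>\<^bsub>DA q\<^esub>) g w = h"
    then obtain w where "set w \<subseteq> S1 q" "length w = n" "foldl (\<otimes>\<^bsub>DA q\<^esub>) g w = h"
      by blast
    then show "\<exists>w. set w \<subseteq> S_Gamma q \<and> length w = n \<and> foldl (\<otimes>\<^bsub>Gamma q\<^esub>) (emb g) w = emb h"
      using emb_word[OF g] by blast
  qed
  then show ?thesis
    using Gamma.word_dist_eq_Least_foldl[OF S_Gamma_subset emb_in_Gamma[OF g] emb_in_Gamma[OF h]]
      DA.word_dist_eq_Least_foldl[OF S1_subset g h] by simp
qed

end

theorem lemma5p1:
  fixes q :: nat
  assumes "q \<ge> 2"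
  shows "\<exists>f \<in> carrier (DA q) \<rightarrow> carrier (Gamma q).
    \<forall>x\<in>carrier (DA q). \<forall>y\<in>carrier (DA q).
      word_dist (Gamma q) (S_Gamma q) (f x) (f y) = word_dist (DA q) (S1 q) x y"
proof -
  interpret tree q
    by unfold_locales (rule assms)
  show ?thesis
    using emb_in_Gamma word_dist_emb by (intro bexI[of _ emb]) auto
qed

end
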